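(* Let $\Gamma$ be a connected graph with $n$ vertices. Then for all $i,j$ there is an isomorphism of vector spaces $$\varphi\colon H^{i,\le j}_{\Phi+d}(\Gamma)/H^{i,\le j-1}_{\Phi+d}(\Gamma)\;\cong\;\frac{\operatorname{Ker}\big(\Phi\colon H^{i,j}(\Gamma)\to H^{i+1,j-2}(\Gamma)\big)}{\operatorname{Im}\big(\Phi\colon H^{i-1,j+2}(\Gamma)\to H^{i,j}(\Gamma)\big)}.$$
   Context: Let $\Gamma$ be a finite graph with totally ordered edges. States. A state is a spanning subgraph $s$ (all vertices, a subset of the edges). Its dimension is its number of edges. An enhanced state labels each connected component of $s$ by $1$ or $x$. Its degree is the number of $x$-labels. Cochain groups. $C^{i,j}(\Gamma)$ is the $\mathbb{Q}$-space with basis the enhanced states of dimension $i$ and degree $j$. Sign. Let $n(s,e)$ be the number of edges of $s$ smaller than $e$. Chromatic differential $d\colon C^{i,j}\to C^{i+1,j}$. Set $d(S)=\sum_{e\notin s}(-1)^{n(s,e)}T_e$, where: - $T_e$ is the enhanced state on $s\cup\{e\}$ with the same labels if $e$ joins a component to itself; - if $e$ joins components labelled $a,b$, the merged component gets label $ab$ in $\mathbb{Q}[x]/(x^2)$ ($1\cdot 1=1$, $1\cdot x=x\cdot 1=x$, $x\cdot x=0$, zero term if $ab=0$). The chromatic cohomology is $H^{i,j}(\Gamma)=\ker(d|_{C^{i,j}})/\operatorname{im}(d|_{C^{i-1,j}})$. The map $\Phi\colon C^{i,j}\to C^{i+1,j-2}$. Set $\Phi(S)=\sum(-1)^{n(s,e)}U_e$,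 summed over the edges $e\notin s$ joining two distinct $x$-labelled components of $s$. Here $U_e$ is the enhanced state on $s\cup\{e\}$ with the merged component labelled $1$. Properties used in the statement. $\Phi^2=0$ and $\Phi d+d\Phi=0$, so $\Phi$ induces maps $\Phi\colon H^{i,j}(\Gamma)\to H^{i+1,j-2}(\Gamma)$. The sum $\Phi+d$ is a differential. Filtration. Let $C^{i,\le j}=\bigoplus_{k\le j}C^{i,k}$, which is preserved by $\Phi+d$. Define $H^{i,\le j}_{\Phi+d}(\Gamma)$ as the image of $H^i(C^{*,\le j},\Phi+d)\to H^i(C^*,\Phi+d)$ induced by inclusion. *)

theory Defs
  imports "HOL-Algebra.Algebra" "HOL-Library.Poly_Mapping"
begin

section \<open>Subquotients of vector spaces\<close>

text \<open>
  A rational vector space is a \<^locale>\<open>module\<close> over \<open>rat_field\<close>. The fields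
  \<^const>\<open>monoid.mult\<close> and \<^const>\<open>monoid.one\<close> of the module record play no role and are filled
  arbitrarily.
\<close>

definition rat_field :: "rat ring" where
  "rat_field = \<lparr>carrier = UNIV, monoid.mult = (*), monoid.one = 1, ring.zero = 0, ring.add = (+)\<rparr>"

text \<open>\<open>quot_module M N\<close> is the quotient \<open>M / N\<close>; its elements are the cosets \<open>N + x\<close>.\<close>

definition quot_module :: "('k, 'b) module \<Rightarrow> 'b set \<Rightarrow> ('k, 'b set) module" where
  "quot_module M N =
    \<lparr>carrier = a_rcosets\<^bsub>M\<^esub> N, monoid.mult = (\<lambda>_ _. N), monoid.one = N,
     ring.zero = N, ring.add = (\<lambda>U W. U <+>\<^bsub>M\<^esub> W),
     smult = (\<lambda>c U. \<Union>x\<in>U. N +>\<^bsub>M\<^esub> (c \<odot>\<^bsub>M\<^esub> x))\<rparr>"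

text \<open>
  \<open>cohomology L f M g P\<close> is the cohomology at \<open>M\<close> of \<open>L \<rightarrow> M \<rightarrow> P\<close>, i.e. \<open>ker g / im f\<close>.
\<close>

definition cohomology ::
  "('k, 'a) module \<Rightarrow> ('a \<Rightarrow> 'b) \<Rightarrow> ('k, 'b) module \<Rightarrow> ('b \<Rightarrow> 'c) \<Rightarrow> ('k, 'c) module
    \<Rightarrow> ('k, 'b set) module" where
  "cohomology L f M g P =
    quot_module (M\<lparr>carrier := a_kernel M P g\<rparr>) (f ` carrier L)"

text \<open>
  The map between quotients induced by \<open>f\<close>, where the target is a subquotient of \<open>M\<close> with
  denominator \<open>N\<close>: it sends the class of \<open>x\<close> to the coset \<open>N + f x\<close>.
\<close>

definition induced_map ::
  "('k, 'b) module \<Rightarrow> 'b set \<Rightarrow> ('a \<Rightarrow> 'b) \<Rightarrow> 'a set \<Rightarrow> 'b set" where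
  "induced_map M N f U = (\<Union>x\<in>U. N +>\<^bsub>M\<^esub> f x)"

definition linear_iso ::
  "('k, 'm) ring_scheme \<Rightarrow> ('k, 'a) module \<Rightarrow> ('k, 'b) module \<Rightarrow> ('a \<Rightarrow> 'b) set" where
  "linear_iso K M N =
    {h. module K M \<and> module K N \<and>
        bij_betw h (carrier M) (carrier N) \<and>
        (\<forall>x\<in>carrier M. \<forall>y\<in>carrier M. h (x \<oplus>\<^bsub>M\<^esub> y) = h x \<oplus>\<^bsub>N\<^esub> h y) \<and>
        (\<forall>c\<in>carrier K. \<forall>x\<in>carrier M. h (c \<odot>\<^bsub>M\<^esub> x) = c \<odot>\<^bsub>N\<^esub> h x)}"

section \<open>Graphs\<close>

text \<open>
  Loops and multiple edges are allowed. \<open>ends G e = (u, v)\<close> means that \<open>e\<close> joins \<open>u\<close> and \<open>v\<close>;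
  the order of the two endpoints is irrelevant in everything that follows. The total order on the
  edges is that of the type \<open>'e\<close>.
\<close>

record ('v, 'e) graph =
  verts :: "'v set"
  edges :: "'e set"
  ends :: "'e \<Rightarrow> 'v \<times> 'v"

definition finite_graph :: "('v, 'e) graph \<Rightarrow> bool" where
  "finite_graph G \<longleftrightarrow>
    finite (verts G) \<and> finite (edges G) \<and> (\<forall>e\<in>edges G. ends G e \<in> verts G \<times> verts G)"

definition adj :: "('v, 'e) graph \<Rightarrow> 'e set \<Rightarrow> ('v \<times> 'v) set" where
  "adj G s = {(u, v). \<exists>e\<in>s. ends G e = (u, v) \<or> ends G e = (v, u)}"

text \<open>Connected component of a vertex, and all components, of the spanning subgraph \<open>s\<close>.\<close>

definition comp_of :: "('v, 'e) graph \<Rightarrow> 'e set \<Rightarrow> 'v \<Rightarrow> 'v set" where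
  "comp_of G s v = (adj G s)\<^sup>* `` {v}"

definition graph_components :: "('v, 'e) graph \<Rightarrow> 'e set \<Rightarrow> 'v set set" where
  "graph_components G s = comp_of G s ` verts G"

definition connected_graph :: "('v, 'e) graph \<Rightarrow> bool" where
  "connected_graph G \<longleftrightarrow>
    verts G \<noteq> {} \<and> (\<forall>u\<in>verts G. \<forall>v\<in>verts G. (u, v) \<in> (adj G (edges G))\<^sup>*)"

section \<open>Enhanced states and cochains\<close>

datatype label = LOne | LX

text \<open>The product of basis elements of \<open>\<rat>[x]/(x^2)\<close>; \<^const>\<open>None\<close> stands for zero.\<close>

fun label_mult :: "label \<Rightarrow> label \<Rightarrow> label option" where
  "label_mult LOne b = Some b"
| "label_mult LX LOne = Some LX"
| "label_mult LX LX = None"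

text \<open>
  An enhanced state is an edge set \<open>s\<close> together with a labelling whose domain is exactly the set of
  components of \<open>s\<close>.
\<close>

type_synonym ('v, 'e) estate = "'e set \<times> ('v set \<rightharpoonup> label)"

definition estates :: "('v, 'e) graph \<Rightarrow> ('v, 'e) estate set" where
  "estates G = {(s, l). s \<subseteq> edges G \<and> dom l = graph_components G s}"

definition state_dim :: "('v, 'e) estate \<Rightarrow> int" where
  "state_dim S = int (card (fst S))"

definition state_deg :: "('v, 'e) estate \<Rightarrow> int" where
  "state_deg S = int (card {A. snd S A = Some LX})"

definition scale :: "rat \<Rightarrow> ('a \<Rightarrow>\<^sub>0 rat) \<Rightarrow> ('a \<Rightarrow>\<^sub>0 rat)" where
  "scale c f = Poly_Mapping.map ((*) c) f"

text \<open>The rational vector space with basis \<open>B\<close>.\<close>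

definition free_space :: "'a set \<Rightarrow> (rat, 'a \<Rightarrow>\<^sub>0 rat) module" where
  "free_space B =
    \<lparr>carrier = {f. Poly_Mapping.keys f \<subseteq> B}, monoid.mult = (\<lambda>_ _. 0), monoid.one = 0,
     ring.zero = 0, ring.add = (+), smult = scale\<rparr>"

definition linear_ext :: "('a \<Rightarrow> ('b \<Rightarrow>\<^sub>0 rat)) \<Rightarrow> ('a \<Rightarrow>\<^sub>0 rat) \<Rightarrow> ('b \<Rightarrow>\<^sub>0 rat)" where
  "linear_ext F f = (\<Sum>S\<in>Poly_Mapping.keys f. scale (Poly_Mapping.lookup f S) (F S))"

text \<open>
  \<open>C^{i,j}\<close>, \<open>C^{i,\<le>j}\<close> and \<open>C^i\<close>. The indices are integers, so that the groups outside the range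
  of the grading are zero.
\<close>

definition Coch :: "('v, 'e) graph \<Rightarrow> int \<Rightarrow> int \<Rightarrow> (rat, ('v, 'e) estate \<Rightarrow>\<^sub>0 rat) module" where
  "Coch G i j = free_space {S \<in> estates G. state_dim S = i \<and> state_deg S = j}"

definition Coch_le :: "('v, 'e) graph \<Rightarrow> int \<Rightarrow> int \<Rightarrow> (rat, ('v, 'e) estate \<Rightarrow>\<^sub>0 rat) module" where
  "Coch_le G i j = free_space {S \<in> estates G. state_dim S = i \<and> state_deg S \<le> j}"

definition Coch_all :: "('v, 'e) graph \<Rightarrow> int \<Rightarrow> (rat, ('v, 'e) estate \<Rightarrow>\<^sub>0 rat) module" where
  "Coch_all G i = free_space {S \<in> estates G. state_dim S = i}"

section \<open>The chromatic differential and the map \<open>\<Phi>\<close>\<close>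

definition edge_sign :: "'e::linorder set \<Rightarrow> 'e \<Rightarrow> rat" where
  "edge_sign s e = (-1) ^ card {e' \<in> s. e' < e}"

text \<open>Replace the components \<open>A\<close> and \<open>B\<close> by their union, labelled \<open>c\<close>.\<close>

definition merge_labels :: "('v set \<rightharpoonup> label) \<Rightarrow> 'v set \<Rightarrow> 'v set \<Rightarrow> label \<Rightarrow> ('v set \<rightharpoonup> label)" where
  "merge_labels l A B c = (l(A := None, B := None))(A \<union> B := Some c)"

definition T_edge ::
  "('v, 'e) graph \<Rightarrow> ('v, 'e) estate \<Rightarrow> 'e \<Rightarrow> ('v, 'e) estate \<Rightarrow>\<^sub>0 rat" where
  "T_edge G S e =
    (let s = fst S; l = snd S;
         A = comp_of G s (fst (ends G e)); B = comp_of G s (snd (ends G e))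
     in if A = B then Poly_Mapping.single (insert e s, l) 1
        else case label_mult (the (l A)) (the (l B)) of
               None \<Rightarrow> 0
             | Some c \<Rightarrow> Poly_Mapping.single (insert e s, merge_labels l A B c) 1)"

definition U_edge ::
  "('v, 'e) graph \<Rightarrow> ('v, 'e) estate \<Rightarrow> 'e \<Rightarrow> ('v, 'e) estate \<Rightarrow>\<^sub>0 rat" where
  "U_edge G S e =
    (let s = fst S; l = snd S;
         A = comp_of G s (fst (ends G e)); B = comp_of G s (snd (ends G e))
     in if A \<noteq> B \<and> l A = Some LX \<and> l B = Some LX
        then Poly_Mapping.single (insert e s, merge_labels l A B LOne) 1
        else 0)"

definition chrom_d ::
  "('v, 'e::linorder) graph \<Rightarrow> (('v, 'e) estate \<Rightarrow>\<^sub>0 rat) \<Rightarrow> (('v, 'e) estate \<Rightarrow>\<^sub>0 rat)" where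
  "chrom_d G = linear_ext (\<lambda>S. \<Sum>e\<in>edges G - fst S. scale (edge_sign (fst S) e) (T_edge G S e))"

definition Phi ::
  "('v, 'e::linorder) graph \<Rightarrow> (('v, 'e) estate \<Rightarrow>\<^sub>0 rat) \<Rightarrow> (('v, 'e) estate \<Rightarrow>\<^sub>0 rat)" where
  "Phi G = linear_ext (\<lambda>S. \<Sum>e\<in>edges G - fst S. scale (edge_sign (fst S) e) (U_edge G S e))"

definition Phi_d ::
  "('v, 'e::linorder) graph \<Rightarrow> (('v, 'e) estate \<Rightarrow>\<^sub>0 rat) \<Rightarrow> (('v, 'e) estate \<Rightarrow>\<^sub>0 rat)" where
  "Phi_d G f = Phi G f + chrom_d G f"

section \<open>Cohomology\<close>

definition chrom_H ::
  "('v, 'e::linorder) graph \<Rightarrow> int \<Rightarrow> int \<Rightarrow> (rat, (('v, 'e) estate \<Rightarrow>\<^sub>0 rat) set) module" where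
  "chrom_H G i j = cohomology (Coch G (i - 1) j) (chrom_d G) (Coch G i j) (chrom_d G) (Coch G (i + 1) j)"

text \<open>\<open>Phi_H G i j\<close> is the induced map \<open>H^{i,j} \<rightarrow> H^{i+1,j-2}\<close>.\<close>

definition Phi_H ::
  "('v, 'e::linorder) graph \<Rightarrow> int \<Rightarrow> int
    \<Rightarrow> (('v, 'e) estate \<Rightarrow>\<^sub>0 rat) set \<Rightarrow> (('v, 'e) estate \<Rightarrow>\<^sub>0 rat) set" where
  "Phi_H G i j = induced_map (Coch G (i + 1) (j - 2)) (chrom_d G ` carrier (Coch G i (j - 2))) (Phi G)"

text \<open>\<open>H^i(C^{*,\<le>j}, \<Phi>+d)\<close> and \<open>H^i(C^*, \<Phi>+d)\<close>.\<close>

definition H_Phi_d_sub ::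
  "('v, 'e::linorder) graph \<Rightarrow> int \<Rightarrow> int \<Rightarrow> (rat, (('v, 'e) estate \<Rightarrow>\<^sub>0 rat) set) module" where
  "H_Phi_d_sub G i j =
    cohomology (Coch_le G (i - 1) j) (Phi_d G) (Coch_le G i j) (Phi_d G) (Coch_le G (i + 1) j)"

definition H_Phi_d ::
  "('v, 'e::linorder) graph \<Rightarrow> int \<Rightarrow> (rat, (('v, 'e) estate \<Rightarrow>\<^sub>0 rat) set) module" where
  "H_Phi_d G i =
    cohomology (Coch_all G (i - 1)) (Phi_d G) (Coch_all G i) (Phi_d G) (Coch_all G (i + 1))"

text \<open>
  \<open>H^{i,\<le>j}_{\<Phi>+d}\<close>: the image in \<open>H^i(C^*, \<Phi>+d)\<close> of the map induced by the inclusion, as a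
  subspace.
\<close>

definition H_Phi_d_le ::
  "('v, 'e::linorder) graph \<Rightarrow> int \<Rightarrow> int \<Rightarrow> (rat, (('v, 'e) estate \<Rightarrow>\<^sub>0 rat) set) module" where
  "H_Phi_d_le G i j =
    (H_Phi_d G i)\<lparr>carrier :=
      induced_map (Coch_all G i) (Phi_d G ` carrier (Coch_all G (i - 1))) (\<lambda>x. x)
        ` carrier (H_Phi_d_sub G i j)\<rparr>"

end

theory Submission
  imports Defs
begin

text \<open>
  The chromatic cohomology of a connected graph with \<open>n\<close> vertices lives on the two diagonals
  \<open>i + j = n\<close> and \<open>i + j = n - 1\<close>. The map \<open>\<Phi>\<close> lowers \<open>i + j\<close> by one, while the differential
  on page \<open>r\<close> of the spectral sequence of the filtered complex lowers it by \<open>2r - 1\<close>, so everything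
  after \<open>\<Phi>\<close> vanishes. Concretely, the isomorphism sends a cocycle of \<open>\<Phi> + d\<close> in filtration
  \<open>\<le> j\<close> to its component of degree \<open>j\<close>, and the two diagonals give exactly the corrections needed
  to see that this is well defined, injective and surjective.

  The two diagonals come from deletion and contraction, carried out inside the fixed graph: the
  states \<open>s\<close> with \<open>K \<subseteq> s \<subseteq> F\<close> span the complex of the minor in which \<open>K\<close> is contracted and the
  complement of \<open>F\<close> is deleted. Prescribing the label of one base vertex in every component of \<open>F\<close>
  makes the cohomology concentrated on a single diagonal; the label \<open>x\<close> at the base vertex gives
  the subcomplex and the label \<open>1\<close> the quotient.
\<close>

text \<open>Both sides of the isomorphism are sets of cosets of cosets, and no map is written down
  on them. The cocycles of \<Phi> + d in filtration \<le> j map onto each side, and the two maps are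
  shown to identify the same pairs.

  Behind the single diagonal is an invariant of minors. With one base vertex per component,
  contracting an edge between two components trades one component for one edge, so every leaf of the
  recursion sits at the same position i + j. Bridges are the obstacle: deleting one creates a
  component without a base vertex. Its far end becomes a new base vertex when labelled x; the states
  with label 1 there cancel against the states containing the bridge, because multiplication by 1 is
  invertible. Hence the induction is over sets of base vertices, even for a connected graph that
  starts with only one.

  The relations d^2 = 0, \<Phi> d + d \<Phi> = 0 and \<Phi>^2 = 0 are read off from (\<Phi> + d)^2 =
  0, the most transparent of them, by splitting it into degrees.\<close>

section \<open>Linear maps and quotients of modules\<close>

definition linear_map :: "('k, 'm) ring_scheme \<Rightarrow> ('k, 'a) module \<Rightarrow> ('k, 'b) module \<Rightarrow> ('a \<Rightarrow> 'b) \<Rightarrow> bool" where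
  "linear_map K M N h \<longleftrightarrow>
    h \<in> carrier M \<rightarrow> carrier N \<and>
    (\<forall>x\<in>carrier M. \<forall>y\<in>carrier M. h (x \<oplus>\<^bsub>M\<^esub> y) = h x \<oplus>\<^bsub>N\<^esub> h y) \<and>
    (\<forall>c\<in>carrier K. \<forall>x\<in>carrier M. h (c \<odot>\<^bsub>M\<^esub> x) = c \<odot>\<^bsub>N\<^esub> h x)"

lemma linear_map_closed: "linear_map K M N h \<Longrightarrow> x \<in> carrier M \<Longrightarrow> h x \<in> carrier N"
  by (auto simp: linear_map_def)

lemma linear_map_add:
  "linear_map K M N h \<Longrightarrow> x \<in> carrier M \<Longrightarrow> y \<in> carrier M \<Longrightarrow> h (x \<oplus>\<^bsub>M\<^esub> y) = h x \<oplus>\<^bsub>N\<^esub> h y"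
  by (auto simp: linear_map_def)

lemma linear_map_smult:
  "linear_map K M N h \<Longrightarrow> c \<in> carrier K \<Longrightarrow> x \<in> carrier M \<Longrightarrow> h (c \<odot>\<^bsub>M\<^esub> x) = c \<odot>\<^bsub>N\<^esub> h x"
  by (auto simp: linear_map_def)

lemma linear_map_compose:
  assumes "linear_map K L M g" "linear_map K M N h"
  shows "linear_map K L N (\<lambda>x. h (g x))"
  using assms unfolding linear_map_def by (auto simp: Pi_iff)

text \<open>Every axiom of \<open>N\<close> is an axiom of \<open>M\<close> read through preimages,
  which is why \<open>linear_map\<close> demands no axioms of its target. The zero of a record is a
  field of its own, so its image is fixed by assumption before \<open>N\<close> is known to be a
  group.\<close>

lemma module_surjective_image:
  assumes M: "module K M" and h: "linear_map K M N h" and surj: "h ` carrier M = carrier N"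
    and zero: "h \<zero>\<^bsub>M\<^esub> = \<zero>\<^bsub>N\<^esub>"
  shows "module K N"
proof -
  interpret M: module K M by fact
  note add = linear_map_add[OF h, symmetric] and smult = linear_map_smult[OF h, symmetric]
  have ex: "\<exists>x\<in>carrier M. u = h x" if "u \<in> carrier N" for u
    using that surj by auto
  show ?thesis
  proof (rule moduleI)
    show "cring K" by (rule M.R.cring_axioms)
    show "abelian_group N"
    proof (rule abelian_groupI)
      fix u v w assume "u \<in> carrier N" "v \<in> carrier N" "w \<in> carrier N"
      then obtain x y z where xyz: "x \<in> carrier M" "y \<in> carrier M" "z \<in> carrier M"
        and "u = h x" "v = h y" "w = h z" using ex by metis
      then show "u \<oplus>\<^bsub>N\<^esub> v \<in> carrier N" "u \<oplus>\<^bsub>N\<^esub> v \<oplus>\<^bsub>N\<^esub> w = u \<oplus>\<^bsub>N\<^esub> (v \<oplus>\<^bsub>N\<^esub> w)"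
          "u \<oplus>\<^bsub>N\<^esub> v = v \<oplus>\<^bsub>N\<^esub> u"
        using linear_map_closed[OF h] by (simp_all add: add M.M.a_ac)
    next
      show "\<zero>\<^bsub>N\<^esub> \<in> carrier N" using linear_map_closed[OF h M.M.zero_closed] by (simp add: zero)
    next
      fix u assume "u \<in> carrier N"
      then obtain x where x: "x \<in> carrier M" "u = h x" using ex by metis
      then show "\<zero>\<^bsub>N\<^esub> \<oplus>\<^bsub>N\<^esub> u = u" by (simp add: add flip: zero)
      have "h (\<ominus>\<^bsub>M\<^esub> x) \<oplus>\<^bsub>N\<^esub> u = \<zero>\<^bsub>N\<^esub>" using x by (simp add: add M.M.l_neg flip: zero)
      then show "\<exists>v\<in>carrier N. v \<oplus>\<^bsub>N\<^esub> u = \<zero>\<^bsub>N\<^esub>"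
        using linear_map_closed[OF h] x(1) by (metis M.M.a_inv_closed)
    qed
  next
    fix a b u v assume ab: "a \<in> carrier K" "b \<in> carrier K" and "u \<in> carrier N" "v \<in> carrier N"
    then obtain x y where "x \<in> carrier M" "y \<in> carrier M" "u = h x" "v = h y" using ex by metis
    then show "a \<odot>\<^bsub>N\<^esub> u \<in> carrier N" "(a \<oplus>\<^bsub>K\<^esub> b) \<odot>\<^bsub>N\<^esub> u = a \<odot>\<^bsub>N\<^esub> u \<oplus>\<^bsub>N\<^esub> b \<odot>\<^bsub>N\<^esub> u"
        "a \<odot>\<^bsub>N\<^esub> (u \<oplus>\<^bsub>N\<^esub> v) = a \<odot>\<^bsub>N\<^esub> u \<oplus>\<^bsub>N\<^esub> a \<odot>\<^bsub>N\<^esub> v"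
        "(a \<otimes>\<^bsub>K\<^esub> b) \<odot>\<^bsub>N\<^esub> u = a \<odot>\<^bsub>N\<^esub> (b \<odot>\<^bsub>N\<^esub> u)"
      using ab linear_map_closed[OF h]
      by (simp_all add: add smult M.smult_l_distr M.smult_r_distr M.smult_assoc1)
  next
    fix u assume "u \<in> carrier N"
    then obtain x where "x \<in> carrier M" "u = h x" using ex by metis
    then show "\<one>\<^bsub>K\<^esub> \<odot>\<^bsub>N\<^esub> u = u" by (simp add: smult)
  qed
qed

text \<open>Undo one surjection and apply the other: equal fibres make the result independent of the
  chosen preimage and injective. No map on cosets of cosets has to be described explicitly.\<close>

lemma linear_iso_if_common_cover:
  assumes M: "module K M" and N: "module K N"
    and p: "linear_map K Z M p" "p ` carrier Z = carrier M"
    and q: "linear_map K Z N q" "q ` carrier Z = carrier N"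
    and ker: "\<And>x y. x \<in> carrier Z \<Longrightarrow> y \<in> carrier Z \<Longrightarrow> p x = p y \<longleftrightarrow> q x = q y"
    and add: "\<And>x y. x \<in> carrier Z \<Longrightarrow> y \<in> carrier Z \<Longrightarrow> x \<oplus>\<^bsub>Z\<^esub> y \<in> carrier Z"
    and smult: "\<And>c x. c \<in> carrier K \<Longrightarrow> x \<in> carrier Z \<Longrightarrow> c \<odot>\<^bsub>Z\<^esub> x \<in> carrier Z"
  shows "\<exists>\<phi>. \<phi> \<in> linear_iso K M N"
proof -
  define \<phi> where "\<phi> = (\<lambda>u. q (SOME x. x \<in> carrier Z \<and> p x = u))"
  have phi: "\<phi> (p x) = q x" if "x \<in> carrier Z" for x
  proof -
    have "(SOME y. y \<in> carrier Z \<and> p y = p x) \<in> carrier Z \<and> p (SOME y. y \<in> carrier Z \<and> p y = p x) = p x"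
      by (rule someI_ex) (use that in blast)
    then show ?thesis unfolding \<phi>_def using ker that by blast
  qed
  have "inj_on \<phi> (carrier M)"
    unfolding inj_on_def by (auto simp: phi ker simp flip: p(2))
  moreover have "\<phi> ` carrier M = carrier N"
    using phi by (simp add: image_image flip: p(2) q(2))
  moreover have "\<phi> (u \<oplus>\<^bsub>M\<^esub> v) = \<phi> u \<oplus>\<^bsub>N\<^esub> \<phi> v" if uv: "u \<in> carrier M" "v \<in> carrier M" for u v
  proof -
    obtain x y where "x \<in> carrier Z" "y \<in> carrier Z" "u = p x" "v = p y"
      using uv p(2) by blast
    then show ?thesis
      by (simp add: phi add linear_map_add[OF q(1)] flip: linear_map_add[OF p(1)])
  qed
  moreover have "\<phi> (c \<odot>\<^bsub>M\<^esub> u) = c \<odot>\<^bsub>N\<^esub> \<phi> u" if uv: "c \<in> carrier K" "u \<in> carrier M" for c u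
  proof -
    obtain x where "x \<in> carrier Z" "u = p x"
      using uv p(2) by blast
    then show ?thesis
      using uv(1) by (simp add: phi smult linear_map_smult[OF q(1)] flip: linear_map_smult[OF p(1)])
  qed
  ultimately show ?thesis using M N unfolding linear_iso_def bij_betw_def by blast
qed

locale quotient = module K M + submodule N K M for K :: "('k, 'm) ring_scheme" and M :: "('k, 'a) module" (structure) and N
begin

sublocale abelian_subgroup N M
  by (rule abelian_subgroupI3) (auto simp: additive_subgroup_def subgroup_axioms M.abelian_group_axioms)

lemma coset_eq_iff:
  assumes "x \<in> carrier M" "y \<in> carrier M"
  shows "N +> x = N +> y \<longleftrightarrow> x \<ominus> y \<in> N"
proof
  assume "N +> x = N +> y"
  then have "x \<in> N +> y" using assms(1) a_rcos_self by blast
  then show "x \<ominus> y \<in> N" using assms a_rcos_module by (simp add: a_minus_def)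
next
  assume "x \<ominus> y \<in> N"
  then have "x \<in> N +> y" using assms a_rcos_module by (simp add: a_minus_def)
  then show "N +> x = N +> y" using assms a_repr_independence' by metis
qed

text \<open>Scalar multiplication in \<open>quot_module\<close> is a union over all representatives;
  since \<open>N\<close> is closed under scalars, the members of that union are all the same
  coset.\<close>

lemma coset_smult:
  assumes c: "c \<in> carrier K" and x: "x \<in> carrier M"
  shows "(\<Union>y\<in>N +> x. N +> (c \<odot> y)) = N +> (c \<odot> x)"
proof -
  have "N +> (c \<odot> y) = N +> (c \<odot> x)" if "y \<in> N +> x" for y
  proof -
    have y: "y \<in> carrier M" using that x a_elemrcos_carrier M.abelian_group_axioms by blast
    then have "y \<ominus> x \<in> N" using that x a_rcos_module by (simp add: a_minus_def)
    then have "c \<odot> (y \<ominus> x) \<in> N" using c by simp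
    moreover have "c \<odot> (y \<ominus> x) = c \<odot> y \<ominus> c \<odot> x"
      using c x y by (simp add: a_minus_def smult_r_distr smult_r_minus)
    ultimately show ?thesis using coset_eq_iff c x y by simp
  qed
  then show ?thesis using a_rcos_self[OF x] by blast
qed

lemma carrier_quot_module: "carrier (quot_module M N) = (\<lambda>x. N +> x) ` carrier M"
  by (auto simp: quot_module_def A_RCOSETS_def')

lemma linear_map_coset: "linear_map K M (quot_module M N) (\<lambda>x. N +> x)"
  unfolding linear_map_def
  by (auto simp: quot_module_def A_RCOSETS_def' a_rcos_sum coset_smult)

lemma coset_zero: "N +> \<zero> = \<zero>\<^bsub>quot_module M N\<^esub>"
  using a_coset_add_zero[OF a_subset] by (simp add: quot_module_def)

lemma module_quot_module: "module K (quot_module M N)"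
  by (rule module_surjective_image[OF module_axioms linear_map_coset])
    (simp_all add: carrier_quot_module coset_zero)

end

section \<open>Finitely supported functions as a vector space\<close>

lemma lookup_scale [simp]: "Poly_Mapping.lookup (scale c f) k = c * Poly_Mapping.lookup f k"
  by (simp add: scale_def Poly_Mapping.map.rep_eq when_def)

global_interpretation pm: vector_space "scale :: rat \<Rightarrow> ('a \<Rightarrow>\<^sub>0 rat) \<Rightarrow> 'a \<Rightarrow>\<^sub>0 rat"
  by unfold_locales (auto intro!: poly_mapping_eqI simp: lookup_add algebra_simps)

global_interpretation pmp: vector_space_pair
  "scale :: rat \<Rightarrow> ('a \<Rightarrow>\<^sub>0 rat) \<Rightarrow> 'a \<Rightarrow>\<^sub>0 rat" "scale :: rat \<Rightarrow> ('b \<Rightarrow>\<^sub>0 rat) \<Rightarrow> 'b \<Rightarrow>\<^sub>0 rat"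
  by unfold_locales

abbreviation lin :: "(('a \<Rightarrow>\<^sub>0 rat) \<Rightarrow> ('b \<Rightarrow>\<^sub>0 rat)) \<Rightarrow> bool" where
  "lin \<equiv> Vector_Spaces.linear scale scale"

lemma lin_compose: "lin f \<Longrightarrow> lin g \<Longrightarrow> lin (\<lambda>x. g (f x))"
  using Vector_Spaces.linear_compose[of scale scale f scale g] by (simp add: o_def)

text \<open>The carrier of \<open>free_space B\<close> inside the type of all finitely supported
  functions. Complexes with different bases then share one type, their maps are total functions, and
  inclusions are the identity.\<close>

definition supp_in :: "'a set \<Rightarrow> ('a \<Rightarrow>\<^sub>0 rat) set" where
  "supp_in B = {f. Poly_Mapping.keys f \<subseteq> B}"

lemma supp_in_iff: "f \<in> supp_in B \<longleftrightarrow> (\<forall>k. k \<notin> B \<longrightarrow> Poly_Mapping.lookup f k = 0)"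
  by (auto simp: supp_in_def in_keys_iff subset_iff)

lemma subspace_supp_in: "pm.subspace (supp_in B)"
  by (auto simp: pm.subspace_def supp_in_iff lookup_add)

lemma supp_in_mono: "f \<in> supp_in B \<Longrightarrow> B \<subseteq> Y \<Longrightarrow> f \<in> supp_in Y"
  by (auto simp: supp_in_def)

lemma supp_in_empty: "f \<in> supp_in {} \<Longrightarrow> f = 0"
  by (simp add: supp_in_def)

lemma single_in_supp_in: "S \<in> B \<Longrightarrow> Poly_Mapping.single S c \<in> supp_in B"
  by (auto simp: supp_in_iff lookup_single when_def)

lemma poly_mapping_sum_single:
  "f = (\<Sum>S\<in>Poly_Mapping.keys f. scale (Poly_Mapping.lookup f S) (Poly_Mapping.single S 1))"
  by (rule poly_mapping_eqI)
    (simp add: lookup_sum lookup_single when_def in_keys_iff mult.commute if_distrib cong: if_cong)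

lemma supp_in_induct [consumes 1, case_names zero single add]:
  assumes "f \<in> supp_in B" "P 0"
    "\<And>S c. S \<in> B \<Longrightarrow> P (scale c (Poly_Mapping.single S 1))"
    "\<And>f g. P f \<Longrightarrow> P g \<Longrightarrow> P (f + g)"
  shows "P f"
proof -
  have "P (\<Sum>S\<in>A. scale (Poly_Mapping.lookup f S) (Poly_Mapping.single S 1))"
    if "finite A" "A \<subseteq> B" for A
    using that by (induction A rule: finite_induct) (auto intro: assms)
  then show ?thesis
    using assms(1) poly_mapping_sum_single[of f] by (metis finite_keys supp_in_def mem_Collect_eq)
qed

lemma lin_eq_on_supp_in:
  assumes "lin f" "lin g" "x \<in> supp_in B"
    and "\<And>S. S \<in> B \<Longrightarrow> f (Poly_Mapping.single S 1) = g (Poly_Mapping.single S 1)"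
  shows "f x = g x"
  using assms(3)
  by (induction rule: supp_in_induct)
    (simp_all add: assms pmp.linear_0 pmp.linear_add pmp.linear_scale)

lemma lin_supp_in_image:
  assumes "lin f" "x \<in> supp_in B" "pm.subspace W"
    and "\<And>S. S \<in> B \<Longrightarrow> f (Poly_Mapping.single S 1) \<in> W"
  shows "f x \<in> W"
  using assms(2)
  by (induction rule: supp_in_induct)
    (simp_all add: assms pmp.linear_0 pmp.linear_add pmp.linear_scale
      pm.subspace_0 pm.subspace_add pm.subspace_scale)

lemma linear_ext_superset:
  assumes "finite A" "Poly_Mapping.keys f \<subseteq> A"
  shows "linear_ext F f = (\<Sum>S\<in>A. scale (Poly_Mapping.lookup f S) (F S))"
  unfolding linear_ext_def using assms
  by (intro sum.mono_neutral_left) (auto simp: in_keys_iff)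

lemma lin_linear_ext: "lin (linear_ext F)"
  unfolding Vector_Spaces.linear_iff
proof (intro conjI allI pm.vector_space_axioms)
  fix f g :: "'a \<Rightarrow>\<^sub>0 rat" and c
  let ?A = "Poly_Mapping.keys f \<union> Poly_Mapping.keys g"
  show "linear_ext F (f + g) = linear_ext F f + linear_ext F g"
    using linear_ext_superset[of ?A "f + g" F] linear_ext_superset[of ?A f F]
      linear_ext_superset[of ?A g F] keys_add[of f g]
    by (simp add: lookup_add pm.scale_left_distrib sum.distrib)
  show "linear_ext F (scale c f) = scale c (linear_ext F f)"
    using linear_ext_superset[of "Poly_Mapping.keys f" "scale c f" F]
      linear_ext_superset[of "Poly_Mapping.keys f" f F]
    by (simp add: pm.scale_sum_right subset_iff in_keys_iff)
qed

lemma linear_ext_single [simp]: "linear_ext F (Poly_Mapping.single S 1) = F S"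
  using linear_ext_superset[of "{S}" "Poly_Mapping.single S 1" F] by simp

text \<open>Coordinate projection. A quotient by the span of some basis elements is later modelled
  by the remaining basis elements with the projected differential, so the induction on graphs never
  meets a quotient space.\<close>

definition restr :: "'a set \<Rightarrow> ('a \<Rightarrow>\<^sub>0 rat) \<Rightarrow> ('a \<Rightarrow>\<^sub>0 rat)" where
  "restr B = linear_ext (\<lambda>S. if S \<in> B then Poly_Mapping.single S 1 else 0)"

lemma lookup_restr [simp]:
  "Poly_Mapping.lookup (restr B f) k = (if k \<in> B then Poly_Mapping.lookup f k else 0)"
proof -
  have "Poly_Mapping.lookup (restr B f) k = (\<Sum>S\<in>Poly_Mapping.keys f.
      Poly_Mapping.lookup f S * Poly_Mapping.lookup (if S \<in> B then Poly_Mapping.single S 1 else 0) k)"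
    by (simp add: restr_def linear_ext_def lookup_sum)
  also have "\<dots> = (\<Sum>S\<in>Poly_Mapping.keys f.
      if S = k then (if k \<in> B then Poly_Mapping.lookup f k else 0) else 0)"
    by (rule sum.cong) (auto simp: lookup_single)
  finally show ?thesis by (auto simp: in_keys_iff)
qed

lemma lin_restr: "lin (restr B)"
  unfolding restr_def by (rule lin_linear_ext)

lemmas restr_add = pmp.linear_add[OF lin_restr]
  and restr_diff = pmp.linear_diff[OF lin_restr]
  and restr_0 = pmp.linear_0[OF lin_restr]

lemma restr_in: "restr B f \<in> supp_in B"
  by (simp add: supp_in_iff)

lemma restr_in_Int: "f \<in> supp_in Y \<Longrightarrow> restr B f \<in> supp_in (B \<inter> Y)"
  by (simp add: supp_in_iff)

lemma restr_idem: "f \<in> supp_in B \<Longrightarrow> restr B f = f"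
  by (rule poly_mapping_eqI) (auto simp: supp_in_iff)

lemma restr_disjoint: "f \<in> supp_in Y \<Longrightarrow> B \<inter> Y = {} \<Longrightarrow> restr B f = 0"
  by (rule poly_mapping_eqI) (auto simp: supp_in_iff)

lemma restr_Un: "B \<inter> Y = {} \<Longrightarrow> restr (B \<union> Y) f = restr B f + restr Y f"
  by (rule poly_mapping_eqI) (auto simp: lookup_add)

lemma restr_restr: "restr B (restr Y f) = restr (B \<inter> Y) f"
  by (rule poly_mapping_eqI) auto

section \<open>Subspaces as modules\<close>

definition subspace_module :: "('a \<Rightarrow>\<^sub>0 rat) set \<Rightarrow> (rat, 'a \<Rightarrow>\<^sub>0 rat) module" where
  "subspace_module S =
    \<lparr>carrier = S, monoid.mult = (\<lambda>_ _. 0), monoid.one = 0,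
     ring.zero = 0, ring.add = (+), smult = scale\<rparr>"

lemma subspace_module_simps [simp]:
  "carrier (subspace_module S) = S" "\<zero>\<^bsub>subspace_module S\<^esub> = 0"
  "x \<oplus>\<^bsub>subspace_module S\<^esub> y = x + y" "c \<odot>\<^bsub>subspace_module S\<^esub> x = scale c x"
  by (simp_all add: subspace_module_def)

lemma free_space_eq: "free_space B = subspace_module (supp_in B)"
  by (simp add: free_space_def subspace_module_def supp_in_def)

lemma subspace_module_update [simp]: "subspace_module S\<lparr>carrier := T\<rparr> = subspace_module T"
  by (simp add: subspace_module_def)

lemma carrier_rat_field [simp]: "carrier rat_field = UNIV"
  by (simp add: rat_field_def)

lemma cring_rat_field: "cring rat_field"
  by (rule cringI[OF abelian_groupI comm_monoidI])
    (auto simp: rat_field_def algebra_simps intro: exI[of _ "- x" for x])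

lemma module_subspace_module:
  assumes "pm.subspace S"
  shows "module rat_field (subspace_module S)"
proof (rule moduleI[OF cring_rat_field abelian_groupI])
  fix x assume "x \<in> carrier (subspace_module S)"
  then show "\<exists>y\<in>carrier (subspace_module S). y \<oplus>\<^bsub>subspace_module S\<^esub> x = \<zero>\<^bsub>subspace_module S\<^esub>"
    using assms pm.subspace_neg by (intro bexI[of _ "- x"]) auto
qed (use assms in \<open>auto simp: rat_field_def pm.subspace_0 pm.subspace_add pm.subspace_scale
        pm.scale_left_distrib pm.scale_right_distrib\<close>)

lemma minus_subspace_module:
  assumes "pm.subspace S" "x \<in> S" "y \<in> S"
  shows "x \<ominus>\<^bsub>subspace_module S\<^esub> y = x - y"
proof -
  interpret module rat_field "subspace_module S" by (rule module_subspace_module) fact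
  have "\<ominus>\<^bsub>subspace_module S\<^esub> y = - y"
    by (rule M.minus_equality) (use assms pm.subspace_neg in auto)
  then show ?thesis by (simp add: a_minus_def)
qed

text \<open>Zero and negatives come from multiplication by 0 and by -1.\<close>

lemma (in module) submodule_if_closed:
  assumes "H \<subseteq> carrier M" "H \<noteq> {}"
    and add: "\<And>a b. a \<in> H \<Longrightarrow> b \<in> H \<Longrightarrow> a \<oplus>\<^bsub>M\<^esub> b \<in> H"
    and smult: "\<And>a x. a \<in> carrier R \<Longrightarrow> x \<in> H \<Longrightarrow> a \<odot>\<^bsub>M\<^esub> x \<in> H"
  shows "submodule H R M"
proof (rule submoduleI)
  obtain x where "x \<in> H" using assms(2) by blast
  then show "\<zero>\<^bsub>M\<^esub> \<in> H"
    using smult[of "\<zero>" x] assms(1) by (auto simp: subset_iff)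
  fix a assume "a \<in> H"
  then show "\<ominus>\<^bsub>M\<^esub> a \<in> H"
    using smult[of "\<ominus> \<one>" a] assms(1) by (auto simp: subset_iff smult_l_minus)
qed (use assms in auto)

lemma submodule_subspace_module:
  assumes "pm.subspace S" "pm.subspace N" "N \<subseteq> S"
  shows "submodule N rat_field (subspace_module S)"
proof -
  interpret module rat_field "subspace_module S" by (rule module_subspace_module) fact
  show ?thesis
    by (rule submodule_if_closed)
      (use assms pm.subspace_0[of N] in \<open>auto simp: pm.subspace_add pm.subspace_scale\<close>)
qed

lemma linear_map_minus:
  assumes "module K M" "module K N" and h: "linear_map K M N h"
    and x: "x \<in> carrier M" and y: "y \<in> carrier M"
  shows "h (x \<ominus>\<^bsub>M\<^esub> y) = h x \<ominus>\<^bsub>N\<^esub> h y"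
proof -
  interpret M: module K M by fact
  interpret N: module K N by fact
  have "h (x \<ominus>\<^bsub>M\<^esub> y) = h (x \<oplus>\<^bsub>M\<^esub> (\<ominus>\<^bsub>K\<^esub> \<one>\<^bsub>K\<^esub>) \<odot>\<^bsub>M\<^esub> y)"
    using x y by (simp add: a_minus_def M.smult_l_minus)
  also have "\<dots> = h x \<oplus>\<^bsub>N\<^esub> (\<ominus>\<^bsub>K\<^esub> \<one>\<^bsub>K\<^esub>) \<odot>\<^bsub>N\<^esub> h y"
    using x y h by (simp add: linear_map_add linear_map_smult)
  also have "\<dots> = h x \<ominus>\<^bsub>N\<^esub> h y"
    using linear_map_closed[OF h] x y by (simp add: a_minus_def N.smult_l_minus)
  finally show ?thesis .
qed

text \<open>The same set as the coset in \<open>subspace_module S\<close> for any \<open>S\<close>,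
  so cosets taken in different carriers can be compared directly.\<close>

definition coset :: "('a \<Rightarrow>\<^sub>0 rat) set \<Rightarrow> ('a \<Rightarrow>\<^sub>0 rat) \<Rightarrow> ('a \<Rightarrow>\<^sub>0 rat) set" where
  "coset N x = (\<lambda>h. h + x) ` N"

lemma a_r_coset_subspace_module [simp]: "N +>\<^bsub>subspace_module S\<^esub> x = coset N x"
  by (auto simp: a_r_coset_def' coset_def)

lemma coset_eq_iff:
  assumes "pm.subspace N"
  shows "coset N x = coset N y \<longleftrightarrow> x - y \<in> N"
proof
  assume "coset N x = coset N y"
  then have "0 + x \<in> coset N y" using pm.subspace_0[OF assms] by (auto simp: coset_def)
  then show "x - y \<in> N" by (auto simp: coset_def)
next
  assume *: "x - y \<in> N"
  have "h + x \<in> coset N y" "h + y \<in> coset N x" if "h \<in> N" for h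
    using pm.subspace_add[OF assms that *] pm.subspace_diff[OF assms that *]
    by (auto simp: coset_def image_iff algebra_simps intro: bexI[rotated])
  then show "coset N x = coset N y" by (auto simp: coset_def)
qed

lemma coset_0 [simp]: "coset N 0 = N"
  by (simp add: coset_def)

lemma coset_self: "pm.subspace N \<Longrightarrow> x \<in> coset N x"
  using pm.subspace_0[of N] by (force simp: coset_def)

lemma mem_coset_iff: "y \<in> coset N x \<longleftrightarrow> y - x \<in> N"
  by (force simp: coset_def image_iff algebra_simps)

lemma carrier_quot_subspace:
  "carrier (quot_module (subspace_module S) N) = coset N ` S"
  by (auto simp: quot_module_def A_RCOSETS_def')

text \<open>Well-definedness in disguise: \<open>induced_map\<close> takes a union over all
  representatives, which collapses to one coset as soon as \<open>f\<close> maps denominators to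
  denominators.\<close>

lemma UN_coset_lin:
  assumes "pm.subspace N" "pm.subspace N'" "lin f" "f ` N \<subseteq> N'"
  shows "(\<Union>y\<in>coset N x. coset N' (f y)) = coset N' (f x)"
proof -
  have "coset N' (f y) = coset N' (f x)" if "y \<in> coset N x" for y
    using that assms
    by (auto simp: coset_eq_iff mem_coset_iff simp flip: pmp.linear_diff[OF assms(3)])
  then show ?thesis using coset_self[OF assms(1)] by blast
qed

text \<open>\<open>N\<close> need not be contained in \<open>S\<close>; on the left-hand side of the theorem it is not.\<close>

lemma iterated_quotient:
  assumes sub: "pm.subspace R" "pm.subspace S" "pm.subspace T" "pm.subspace N"
    and incl: "T \<subseteq> S" "S \<subseteq> R" "N \<subseteq> R"
    and Q_eq: "Q = quot_module (quot_module (subspace_module R) N\<lparr>carrier := coset N ` S\<rparr>) (coset N ` T)"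
  shows "\<exists>p. module rat_field Q \<and> linear_map rat_field (subspace_module S) Q p \<and>
    p ` S = carrier Q \<and> (\<forall>x\<in>S. \<forall>y\<in>S. p x = p y \<longleftrightarrow> (\<exists>t\<in>T. x - y - t \<in> N))"
proof -
  let ?R = "quot_module (subspace_module R) N"
  define H where "H = ?R\<lparr>carrier := coset N ` S\<rparr>"
  have Q_def: "Q = quot_module H (coset N ` T)" unfolding H_def by (rule Q_eq)
  interpret R: quotient rat_field "subspace_module R" N
    using sub incl by (simp add: quotient_def module_subspace_module submodule_subspace_module)
  have R_mod: "module rat_field ?R" by (rule R.module_quot_module)
  have lin_R: "linear_map rat_field (subspace_module R) ?R (coset N)"
    using R.linear_map_coset by simp
  have image: "submodule (coset N ` W) rat_field ?R" if "pm.subspace W" "W \<subseteq> R" for W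
  proof (rule module.submodule_if_closed[OF R_mod])
    have *: "coset N x \<oplus>\<^bsub>?R\<^esub> coset N y = coset N (x + y)"
      "c \<odot>\<^bsub>?R\<^esub> coset N x = coset N (scale c x)" if "x \<in> W" "y \<in> W" for x y c
      using linear_map_add[OF lin_R, of x y] linear_map_smult[OF lin_R, of c x] that \<open>W \<subseteq> R\<close>
      by (auto simp: subset_iff)
    show "coset N ` W \<subseteq> carrier ?R" using that by (auto simp: carrier_quot_subspace)
    show "coset N ` W \<noteq> {}" using that(1) pm.subspace_0 by auto
    show "a \<oplus>\<^bsub>?R\<^esub> b \<in> coset N ` W" if "a \<in> coset N ` W" "b \<in> coset N ` W" for a b
      using that \<open>pm.subspace W\<close> by (auto simp: * pm.subspace_add)
    show "c \<odot>\<^bsub>?R\<^esub> a \<in> coset N ` W" if "a \<in> coset N ` W" for a c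
      using that \<open>pm.subspace W\<close> by (auto simp: * pm.subspace_scale)
  qed
  have H_mod: "module rat_field H"
    unfolding H_def by (rule submodule.submodule_is_module[OF image[OF sub(2) incl(2)] R_mod])
  have T_H: "submodule (coset N ` T) rat_field H"
  proof (rule module.submodule_if_closed[OF H_mod])
    have T_R: "submodule (coset N ` T) rat_field ?R" using image incl sub by blast
    show "coset N ` T \<subseteq> carrier H" using incl by (auto simp: H_def)
    show "coset N ` T \<noteq> {}" using sub(3) pm.subspace_0 by auto
    show "a \<oplus>\<^bsub>H\<^esub> b \<in> coset N ` T" if "a \<in> coset N ` T" "b \<in> coset N ` T" for a b
      using module.submoduleE(5)[OF R_mod T_R that] by (simp add: H_def)
    show "c \<odot>\<^bsub>H\<^esub> a \<in> coset N ` T" if "c \<in> carrier rat_field" "a \<in> coset N ` T" for a c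
      using module.submoduleE(4)[OF R_mod T_R that] by (simp add: H_def)
  qed
  interpret H: quotient rat_field H "coset N ` T"
    using H_mod T_H by (simp add: quotient_def)
  have lin_H: "linear_map rat_field (subspace_module S) H (coset N)"
    using lin_R incl(2) unfolding linear_map_def H_def
    by (auto simp: Pi_iff subset_iff)
  define p where "p = (\<lambda>x. coset N ` T +>\<^bsub>H\<^esub> coset N x)"
  show ?thesis
  proof (intro exI[of _ p] conjI ballI)
    show "module rat_field Q" unfolding Q_def by (rule H.module_quot_module)
    show "linear_map rat_field (subspace_module S) Q p"
      unfolding p_def Q_def by (rule linear_map_compose[OF lin_H H.linear_map_coset])
    show "p ` S = carrier Q"
      unfolding p_def Q_def H.carrier_quot_module by (simp add: H_def image_image)
    fix x y assume xy: "x \<in> S" "y \<in> S"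
    have "p x = p y \<longleftrightarrow> coset N x \<ominus>\<^bsub>H\<^esub> coset N y \<in> coset N ` T"
      unfolding p_def using xy by (intro H.coset_eq_iff) (auto simp: H_def)
    also have "coset N x \<ominus>\<^bsub>H\<^esub> coset N y = coset N (x - y)"
      using linear_map_minus[OF module_subspace_module[OF sub(2)] H_mod lin_H, of x y] xy
      by (simp add: minus_subspace_module sub(2))
    \<comment> \<open>\<open>N\<close> need not lie in \<open>T\<close>, so lying in the image of
      \<open>T\<close> means lying in \<open>T\<close> only up to an element of
      \<open>N\<close>.\<close>
    also have "coset N (x - y) \<in> coset N ` T \<longleftrightarrow> (\<exists>t\<in>T. x - y - t \<in> N)"
      using coset_eq_iff[OF sub(4)] by auto
    finally show "p x = p y \<longleftrightarrow> (\<exists>t\<in>T. x - y - t \<in> N)" .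
  qed
qed

section \<open>Collapse of the spectral sequence\<close>

text \<open>What the collapse needs, without graphs: a basis bigraded by \<open>dm\<close> and
  \<open>dg\<close>, a differential of bidegree (1, 0), a second map of bidegree (1, -2), the knight
  move, and exactness off the diagonals \<open>n - 1\<close> and \<open>n\<close>.\<close>

locale knight_move_complex =
  fixes B :: "'a set" and dm dg :: "'a \<Rightarrow> int" and d \<Phi> :: "('a \<Rightarrow>\<^sub>0 rat) \<Rightarrow> ('a \<Rightarrow>\<^sub>0 rat)"
    and n :: int
  fixes cell :: "int \<Rightarrow> int \<Rightarrow> 'a set" and cell_le :: "int \<Rightarrow> int \<Rightarrow> 'a set" and cell_all :: "int \<Rightarrow> 'a set"
  defines "cell \<equiv> \<lambda>i j. {S \<in> B. dm S = i \<and> dg S = j}"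
    and "cell_le \<equiv> \<lambda>i j. {S \<in> B. dm S = i \<and> dg S \<le> j}"
    and "cell_all \<equiv> \<lambda>i. {S \<in> B. dm S = i}"
  assumes lin_d: "lin d" and lin_Phi: "lin \<Phi>"
    and d_closed: "\<And>f i j. f \<in> supp_in (cell i j) \<Longrightarrow> d f \<in> supp_in (cell (i + 1) j)"
    and Phi_closed: "\<And>f i j. f \<in> supp_in (cell i j) \<Longrightarrow> \<Phi> f \<in> supp_in (cell (i + 1) (j - 2))"
    and d_d: "\<And>f. f \<in> supp_in B \<Longrightarrow> d (d f) = 0"
    and anticomm: "\<And>f. f \<in> supp_in B \<Longrightarrow> \<Phi> (d f) + d (\<Phi> f) = 0"
    and Phi_Phi: "\<And>f. f \<in> supp_in B \<Longrightarrow> \<Phi> (\<Phi> f) = 0"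
    and dg_nonneg: "\<And>S. S \<in> B \<Longrightarrow> 0 \<le> dg S"
    and two_diagonals: "\<And>f i j. f \<in> supp_in (cell i j) \<Longrightarrow> d f = 0 \<Longrightarrow> i + j < n - 1 \<or> n < i + j
      \<Longrightarrow> \<exists>g\<in>supp_in (cell (i - 1) j). d g = f"
begin

definition D :: "('a \<Rightarrow>\<^sub>0 rat) \<Rightarrow> ('a \<Rightarrow>\<^sub>0 rat)" where
  "D f = \<Phi> f + d f"

lemma lin_D: "lin D"
  unfolding D_def by (rule pmp.linear_compose_add[OF lin_Phi lin_d])

lemmas d_simps = pmp.linear_add[OF lin_d] pmp.linear_diff[OF lin_d] pmp.linear_neg[OF lin_d]
    pmp.linear_0[OF lin_d]
  and Phi_simps = pmp.linear_add[OF lin_Phi] pmp.linear_diff[OF lin_Phi]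
    pmp.linear_neg[OF lin_Phi] pmp.linear_0[OF lin_Phi]
  and D_simps = pmp.linear_add[OF lin_D] pmp.linear_diff[OF lin_D] pmp.linear_neg[OF lin_D]
    pmp.linear_0[OF lin_D]

lemma cell_subset: "cell i j \<subseteq> cell_all i" "cell_le i j \<subseteq> cell_all i" "cell_all i \<subseteq> B"
    "cell i j \<subseteq> B" "cell_le i j \<subseteq> B" "k \<le> j \<Longrightarrow> cell i k \<subseteq> cell_le i j"
    "k \<le> j \<Longrightarrow> cell_le i k \<subseteq> cell_le i j"
  by (auto simp: cell_def cell_le_def cell_all_def)

lemmas in_mono = cell_subset[THEN supp_in_mono[rotated]]

lemma single_in_cell: "S \<in> B \<Longrightarrow> Poly_Mapping.single S c \<in> supp_in (cell (dm S) (dg S))"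
  by (rule single_in_supp_in) (simp add: cell_def)

lemma d_le:
  assumes "f \<in> supp_in (cell_le i j)"
  shows "d f \<in> supp_in (cell_le (i + 1) j)"
proof (rule lin_supp_in_image[OF lin_d assms subspace_supp_in])
  fix S assume "S \<in> cell_le i j"
  then have "S \<in> B" "dm S = i" "dg S \<le> j" by (auto simp: cell_le_def)
  then show "d (Poly_Mapping.single S 1) \<in> supp_in (cell_le (i + 1) j)"
    using in_mono(6)[OF _ d_closed[OF single_in_cell[of S]], of j] by simp
qed

lemma Phi_le:
  assumes "f \<in> supp_in (cell_le i j)"
  shows "\<Phi> f \<in> supp_in (cell_le (i + 1) (j - 2))"
proof (rule lin_supp_in_image[OF lin_Phi assms subspace_supp_in])
  fix S assume "S \<in> cell_le i j"
  then have "S \<in> B" "dm S = i" "dg S \<le> j" by (auto simp: cell_le_def)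
  then show "\<Phi> (Poly_Mapping.single S 1) \<in> supp_in (cell_le (i + 1) (j - 2))"
    using in_mono(6)[OF _ Phi_closed[OF single_in_cell[of S]], of "j - 2"] by simp
qed

lemma D_le: "f \<in> supp_in (cell_le i j) \<Longrightarrow> D f \<in> supp_in (cell_le (i + 1) j)"
  unfolding D_def using d_le[of f i j] in_mono(7)[OF _ Phi_le[of f i j], of j]
  by (auto intro: pm.subspace_add[OF subspace_supp_in])

text \<open>Finite support bounds the degree of a single cochain, so a descent on the filtration has
  a starting point; \<open>k\<close> lets the bound be taken above a given one.\<close>

lemma all_bounded:
  assumes "f \<in> supp_in (cell_all i)"
  obtains m where "k \<le> m" "f \<in> supp_in (cell_le i m)"
proof
  let ?m = "Max (insert k (dg ` Poly_Mapping.keys f))"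
  show "k \<le> ?m" by simp
  show "f \<in> supp_in (cell_le i ?m)"
    using assms by (auto simp: supp_in_def cell_all_def cell_le_def)
qed

lemma D_all:
  assumes "f \<in> supp_in (cell_all i)"
  shows "D f \<in> supp_in (cell_all (i + 1))"
proof -
  obtain m where "f \<in> supp_in (cell_le i m)" using all_bounded[OF assms, of 0] .
  then show ?thesis by (intro in_mono(2)[OF D_le])
qed

lemma D_D: "f \<in> supp_in B \<Longrightarrow> D (D f) = 0"
  using d_d[of f] Phi_Phi[of f] anticomm[of f] unfolding D_def by (simp add: d_simps Phi_simps)

definition part :: "int \<Rightarrow> ('a \<Rightarrow>\<^sub>0 rat) \<Rightarrow> ('a \<Rightarrow>\<^sub>0 rat)" where
  "part j = restr {S. dg S = j}"

lemma lin_part: "lin (part j)"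
  unfolding part_def by (rule lin_restr)

lemmas part_simps = pmp.linear_add[OF lin_part] pmp.linear_diff[OF lin_part]
    pmp.linear_neg[OF lin_part] pmp.linear_0[OF lin_part]

lemma part_cell: "f \<in> supp_in (cell i k) \<Longrightarrow> part j f = (if j = k then f else 0)"
  by (auto simp: part_def cell_def intro!: restr_idem restr_disjoint elim: supp_in_mono)

lemma part_in_cell: "f \<in> supp_in (cell_all i) \<Longrightarrow> part j f \<in> supp_in (cell i j)"
  unfolding part_def by (drule restr_in_Int[of _ _ "{S. dg S = j}"])
    (auto simp: cell_all_def cell_def elim!: supp_in_mono)

lemma part_le: "f \<in> supp_in (cell_le i k) \<Longrightarrow> k < j \<Longrightarrow> part j f = 0"
  unfolding part_def by (erule restr_disjoint) (auto simp: cell_le_def)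

lemma minus_part_le:
  assumes "f \<in> supp_in (cell_le i j)"
  shows "f - part j f \<in> supp_in (cell_le i (j - 1))"
  using assms by (auto simp: supp_in_iff part_def cell_le_def lookup_minus)

lemma part_d:
  assumes "f \<in> supp_in B"
  shows "part j (d f) = d (part j f)"
  by (rule lin_eq_on_supp_in[OF lin_compose[OF lin_d lin_part] lin_compose[OF lin_part lin_d] assms])
    (simp add: part_cell[OF single_in_cell] part_cell[OF d_closed[OF single_in_cell]] d_simps)

lemma part_Phi:
  assumes "f \<in> supp_in B"
  shows "part j (\<Phi> f) = \<Phi> (part (j + 2) f)"
  by (rule lin_eq_on_supp_in[OF lin_compose[OF lin_Phi lin_part] lin_compose[OF lin_part lin_Phi] assms])
    (auto simp add: part_cell[OF single_in_cell] part_cell[OF Phi_closed[OF single_in_cell]] Phi_simps)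

lemma part_D: "f \<in> supp_in B \<Longrightarrow> part j (D f) = \<Phi> (part (j + 2) f) + d (part j f)"
  by (simp add: D_def part_simps part_d part_Phi)

text \<open>Descent on the filtration: the top part of a cocycle of \<open>D\<close> is a cocycle of
  \<open>d\<close>, below both diagonals it equals \<open>d y\<close>, and subtracting
  \<open>D y\<close> pushes the cocycle down. Lower degrees lie even further below the
  diagonals.\<close>

lemma low_cocycle_exact:
  assumes "r \<in> supp_in (cell_le (i + 1) k)" "D r = 0" "i + 1 + k < n - 1"
  shows "\<exists>y\<in>supp_in (cell_le i k). D y = r"
  using assms
\<comment> \<open>The measure is 0 exactly when k < 0, and then no basis element has degree \<le>
  k.\<close>
proof (induction "nat (k + 1)" arbitrary: k r)
  case 0
  then have "cell_le (i + 1) k = {}"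
    using dg_nonneg by (force simp: cell_le_def)
  then have "r = 0" using 0 supp_in_empty by metis
  then show ?case using pm.subspace_0[OF subspace_supp_in] by (auto simp: D_simps intro!: bexI[of _ 0])
next
  case (Suc m)
  let ?t = "part k r"
  have m: "m = nat (k - 1 + 1)" using Suc.hyps(2) by linarith
  have rB: "r \<in> supp_in B" using Suc.prems in_mono(5) by blast
  have t: "?t \<in> supp_in (cell (i + 1) k)"
    using Suc.prems(1) by (intro part_in_cell in_mono(2))
  have "part k (D r) = d ?t"
    using part_D[OF rB, of k] part_le[OF Suc.prems(1), of "k + 2"] by (simp add: Phi_simps)
  then have "d ?t = 0" using Suc.prems(2) by (simp add: part_simps)
  then obtain y where y: "y \<in> supp_in (cell i k)" "d y = ?t"
    using two_diagonals[OF t] Suc.prems(3) by auto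
  have y': "y \<in> supp_in (cell_le i k)" "y \<in> supp_in B"
    using y(1) in_mono by blast+
  have "\<Phi> y \<in> supp_in (cell_le (i + 1) (k - 1))"
    using Phi_closed[OF y(1)] in_mono(6)[of "k - 2" "k - 1"] by auto
  then have "r - D y \<in> supp_in (cell_le (i + 1) (k - 1))"
    using pm.subspace_diff[OF subspace_supp_in minus_part_le[OF Suc.prems(1)]]
    unfolding D_def y(2) by (metis diff_diff_eq add.commute)
  moreover have "D (r - D y) = 0"
    using Suc.prems(2) D_D[OF y'(2)] by (simp add: D_simps)
  ultimately obtain z where "z \<in> supp_in (cell_le i (k - 1))" "D z = r - D y"
    using Suc.hyps(1)[of "k - 1" "r - D y"] m Suc.prems(3) by auto
  then have "D (y + z) = r" "y + z \<in> supp_in (cell_le i k)"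
    using y'(1) in_mono(7)[of "k - 1" k z i] pm.subspace_add[OF subspace_supp_in]
    by (auto simp: D_simps)
  then show ?case by blast
qed

text \<open>Above both diagonals the top part of a primitive can be removed: in degrees above
  \<open>k\<close> the image \<open>D w\<close> has no component, so the top part is a cocycle of
  \<open>d\<close>, hence \<open>d y\<close>, and subtracting \<open>D y\<close> leaves
  \<open>D w\<close> unchanged.\<close>

lemma primitive_bounded:
  assumes "w \<in> supp_in (cell_all i)" "D w \<in> supp_in (cell_le (i + 1) k)" "n \<le> i + k"
  shows "\<exists>w'\<in>supp_in (cell_le i k). D w' = D w"
proof -
  obtain m where "k \<le> m" "w \<in> supp_in (cell_le i m)"
    using all_bounded[OF assms(1)] .
  then show ?thesis
    using assms(2)
  proof (induction "nat (m - k)" arbitrary: m w)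
    case 0
    then show ?case by auto
  next
    case (Suc l)
    let ?t = "part m w"
    have km: "k < m" "l = nat (m - 1 - k)" using Suc.hyps(2) by linarith+
    have wB: "w \<in> supp_in B" using Suc.prems in_mono(5) by blast
    have t: "?t \<in> supp_in (cell i m)"
      using Suc.prems(2) by (intro part_in_cell in_mono(2))
    have "part m (D w) = d ?t"
      using part_D[OF wB, of m] part_le[OF Suc.prems(2), of "m + 2"] by (simp add: Phi_simps)
    moreover have "part m (D w) = 0"
      using part_le[OF Suc.prems(3)] km by auto
    ultimately obtain y where y: "y \<in> supp_in (cell (i - 1) m)" "d y = ?t"
      using two_diagonals[OF t] km assms(3) by auto
    have yB: "y \<in> supp_in B" using y(1) in_mono by blast
    have "\<Phi> y \<in> supp_in (cell_le i (m - 1))"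
      using Phi_closed[OF y(1)] in_mono(6)[of "m - 2" "m - 1"] by auto
    then have "w - D y \<in> supp_in (cell_le i (m - 1))"
      using pm.subspace_diff[OF subspace_supp_in minus_part_le[OF Suc.prems(2)]]
      unfolding D_def y(2) by (metis diff_diff_eq add.commute)
    moreover have "D (w - D y) = D w"
      using D_D[OF yB] by (simp add: D_simps)
    ultimately show ?case
      using Suc.hyps(1)[of "m - 1" "w - D y"] km Suc.prems(3) by auto
  qed
qed

text \<open>Surjectivity of taking leading parts. Above the diagonals z = d v, and
  \<open>D v\<close> is a cocycle with leading part \<open>z\<close>. Otherwise \<open>z - u\<close>
  fails to be a cocycle only by \<Phi> u in degree j - 4, which lies too low to obstruct.\<close>

lemma extend_to_cocycle:
  assumes z: "z \<in> supp_in (cell i j)" "d z = 0" and u: "u \<in> supp_in (cell i (j - 2))" "\<Phi> z = d u"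
  shows "\<exists>x\<in>supp_in (cell_le i j). D x = 0 \<and> part j x = z"
proof (cases "n < i + j")
  case True
  then obtain v where v: "v \<in> supp_in (cell (i - 1) j)" "d v = z"
    using two_diagonals[OF z] by auto
  have vB: "v \<in> supp_in B" "v \<in> supp_in (cell_le (i - 1) j)" using v(1) in_mono by blast+
  have "part j (D v) = z"
    using part_D[OF vB(1)] part_cell[OF v(1)] v(2) by (simp add: Phi_simps)
  then show ?thesis using D_D[OF vB(1)] D_le[OF vB(2)] by auto
next
  case False
  have uB: "u \<in> supp_in B" using u(1) in_mono by blast
  have zB: "z \<in> supp_in B" using z(1) in_mono by blast
  have "D (z - u) = - \<Phi> u" using z(2) u(2) by (simp add: D_def Phi_simps d_simps)
  moreover have "D (- \<Phi> u) = 0"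
    using D_D[OF pm.subspace_diff[OF subspace_supp_in zB uB]] calculation by simp
  moreover have "- \<Phi> u \<in> supp_in (cell_le (i + 1) (j - 4))"
    using in_mono(6)[OF _ Phi_closed[OF u(1)], of "j - 4"] pm.subspace_neg[OF subspace_supp_in]
    by auto
  \<comment> \<open>The position is (i + 1) + (j - 4) = i + j - 3, at most n - 3 in this case, hence
    strictly below both diagonals.\<close>
  ultimately obtain y where y: "y \<in> supp_in (cell_le i (j - 4))" "D y = D (z - u)"
    using low_cocycle_exact[of "- \<Phi> u" i "j - 4"] False by auto
  have "z \<in> supp_in (cell_le i j)" "u \<in> supp_in (cell_le i j)" "y \<in> supp_in (cell_le i j)"
    using z u y in_mono(6)[of j j] in_mono(6)[of "j - 2" j] in_mono(7)[of "j - 4" j] by auto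
  then have "z - u - y \<in> supp_in (cell_le i j)"
    by (intro pm.subspace_diff[OF subspace_supp_in])
  moreover have "D (z - u - y) = 0" using y(2) by (simp add: D_simps)
  moreover have "part j (z - u - y) = z"
    using part_cell[OF z(1)] part_cell[OF u(1)] part_le[OF y(1)] by (simp add: part_simps)
  ultimately show ?thesis by blast
qed

text \<open>Well-definedness and injectivity at once. On the left, \<open>x\<close> vanishes in the
  quotient of successive filtration steps; on the right, its leading part vanishes in the homology
  of \<Phi> on the cohomology of \<open>d\<close>.\<close>

lemma same_leading_class_iff:
  assumes x: "x \<in> supp_in (cell_le i j)" "D x = 0"
  shows "(\<exists>t\<in>supp_in (cell_le i (j - 1)). D t = 0 \<and> (\<exists>w\<in>supp_in (cell_all (i - 1)). x - t = D w))
    \<longleftrightarrow> (\<exists>w\<in>supp_in (cell (i - 1) (j + 2)). \<exists>y\<in>supp_in (cell (i - 1) j).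
          d w = 0 \<and> part j x = \<Phi> w + d y)"
    (is "?L \<longleftrightarrow> ?R")
proof
  assume ?R
  then obtain w y where w: "w \<in> supp_in (cell (i - 1) (j + 2))" "d w = 0"
    and y: "y \<in> supp_in (cell (i - 1) j)" and xj: "part j x = \<Phi> w + d y" by blast
  have wy: "w + y \<in> supp_in (cell_all (i - 1))"
    using w y in_mono(1) by (auto intro: pm.subspace_add[OF subspace_supp_in])
  \<comment> \<open>Of the four terms of \<open>D (w + y)\<close>, \<open>d w\<close> vanishes,
    \<Phi> w + d y is the leading part of \<open>x\<close>, and \<Phi> y has degree j - 2.\<close>
  have "x - D (w + y) = (x - part j x) - \<Phi> y"
    by (simp add: xj D_def d_simps Phi_simps w(2) algebra_simps)
  moreover have "\<Phi> y \<in> supp_in (cell_le i (j - 1))"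
    using Phi_closed[OF y] in_mono(6)[of "j - 2" "j - 1"] by auto
  ultimately have "x - D (w + y) \<in> supp_in (cell_le i (j - 1))"
    using pm.subspace_diff[OF subspace_supp_in minus_part_le[OF x(1)]] by metis
  moreover have "D (x - D (w + y)) = 0"
    using D_D[OF in_mono(3)[OF wy]] x(2) by (simp add: D_simps)
  moreover have "x - (x - D (w + y)) = D (w + y)" by simp
  ultimately show ?L using wy by blast
next
  assume ?L
  then obtain t w where t: "t \<in> supp_in (cell_le i (j - 1))" "D t = 0"
    and w: "w \<in> supp_in (cell_all (i - 1))" and xt: "x - t = D w" by blast
  have zero: "0 \<in> supp_in A" for A :: "'a set" using pm.subspace_0[OF subspace_supp_in] .
  show ?R
  proof (cases "i + j < n - 1")
    case True
    have "part j (D x) = d (part j x)"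
      using part_D[OF in_mono(5)[OF x(1)], of j] part_le[OF x(1), of "j + 2"] by (simp add: Phi_simps)
    then have "d (part j x) = 0" using x(2) by (simp add: part_simps)
    then obtain y where "y \<in> supp_in (cell (i - 1) j)" "d y = part j x"
      using two_diagonals[OF part_in_cell[OF in_mono(2)[OF x(1)]]] True by blast
    moreover have "d 0 = 0" "\<Phi> 0 = 0" by (simp_all add: d_simps Phi_simps)
    ultimately show ?thesis
      by (intro bexI[of _ y] bexI[OF _ zero]) simp_all
  next
    case False
    have le: "D w \<in> supp_in (cell_le i j)"
      using x(1) t(1) in_mono(7)[of "j - 1" j] unfolding xt[symmetric]
      by (auto intro: pm.subspace_diff[OF subspace_supp_in])
    \<comment> \<open>The primitive can be bounded by degree j + 2 because (i - 1) + (j + 2) = i + j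
      + 1 is at least n in this case. Its parts in degrees j + 2 and j are the two
      witnesses.\<close>
    then have "D w \<in> supp_in (cell_le (i - 1 + 1) (j + 2))"
      using in_mono(7)[of j "j + 2"] by simp
    then obtain v where v: "v \<in> supp_in (cell_le (i - 1) (j + 2))" "D v = D w"
      using primitive_bounded[OF w, of "j + 2"] False by auto
    have vB: "v \<in> supp_in B" "v \<in> supp_in (cell_all (i - 1))" using v(1) in_mono by blast+
    have "part (j + 2) (D v) = 0" using v(2) le part_le by simp
    then have "d (part (j + 2) v) = 0"
      using part_D[OF vB(1), of "j + 2"] part_le[OF v(1), of "j + 2 + 2"] by (simp add: Phi_simps)
    moreover have "part j (D v) = part j x"
      using part_le[OF t(1), of j] by (simp add: v(2) part_simps flip: xt)
    ultimately show ?thesis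
      using part_D[OF vB(1), of j]
      by (intro bexI[OF _ part_in_cell[OF vB(2)]]) simp
  qed
qed

end

section \<open>Both sides as nested quotients of one space of cocycles\<close>

lemma cohomology_subspace_module:
  "cohomology (subspace_module R) f (subspace_module S) g (subspace_module T) =
    quot_module (subspace_module {x \<in> S. g x = 0}) (f ` R)"
  by (simp add: cohomology_def a_kernel_def')

lemma subspace_kernel_in: "lin f \<Longrightarrow> pm.subspace S \<Longrightarrow> pm.subspace {x \<in> S. f x = 0}"
  by (auto simp: pm.subspace_def pmp.linear_0 pmp.linear_add pmp.linear_scale)

lemma subspace_preimage_in:
  "lin f \<Longrightarrow> pm.subspace S \<Longrightarrow> pm.subspace T \<Longrightarrow> pm.subspace {x \<in> S. f x \<in> T}"
  by (auto simp: pm.subspace_def pmp.linear_0 pmp.linear_add pmp.linear_scale)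

lemma linear_map_subspace_module:
  "lin f \<Longrightarrow> f ` S \<subseteq> T \<Longrightarrow> linear_map K (subspace_module S) (subspace_module T) f"
  by (auto simp: linear_map_def pmp.linear_add pmp.linear_scale)

context knight_move_complex
begin

text \<open>This and the following groups copy those of the theorem over the abstract basis, in the
  same syntactic form, so that unfolding identifies them in the end.\<close>

definition "H_tot i = cohomology (free_space (cell_all (i - 1))) D (free_space (cell_all i)) D
  (free_space (cell_all (i + 1)))"

definition "H_sub i j = cohomology (free_space (cell_le (i - 1) j)) D (free_space (cell_le i j)) D
  (free_space (cell_le (i + 1) j))"

definition "H_le i j = H_tot i\<lparr>carrier :=
  induced_map (free_space (cell_all i)) (D ` carrier (free_space (cell_all (i - 1)))) (\<lambda>x. x)
    ` carrier (H_sub i j)\<rparr>"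

definition "H_d i j = cohomology (free_space (cell (i - 1) j)) d (free_space (cell i j)) d
  (free_space (cell (i + 1) j))"

definition "H_Phi i j =
  induced_map (free_space (cell (i + 1) (j - 2))) (d ` carrier (free_space (cell i (j - 2)))) \<Phi>"

definition "Z_tot i = {x \<in> supp_in (cell_all i). D x = 0}"

definition "B_tot i = D ` supp_in (cell_all (i - 1))"

definition "Z_le i j = {x \<in> supp_in (cell_le i j). D x = 0}"

definition "Z_d i j = {x \<in> supp_in (cell i j). d x = 0}"

definition "B_d i j = d ` supp_in (cell (i - 1) j)"

lemma subspaces: "pm.subspace (Z_tot i)" "pm.subspace (B_tot i)" "pm.subspace (Z_le i j)"
    "pm.subspace (Z_d i j)" "pm.subspace (B_d i j)"
  unfolding Z_tot_def B_tot_def Z_le_def Z_d_def B_d_def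
  by (intro subspace_kernel_in pmp.linear_subspace_image subspace_supp_in lin_D lin_d)+

lemma B_tot_subset: "B_tot i \<subseteq> Z_tot i"
  unfolding B_tot_def Z_tot_def using D_all[of _ "i - 1"] D_D[OF in_mono(3)] by auto

lemma B_d_subset: "B_d i j \<subseteq> Z_d i j"
  unfolding B_d_def Z_d_def using d_closed[of _ "i - 1" j] d_d[OF in_mono(4)] by auto

lemma Z_le_subset: "Z_le i j \<subseteq> Z_tot i" "Z_le i (j - 1) \<subseteq> Z_le i j"
  unfolding Z_le_def Z_tot_def using in_mono(2) in_mono(7)[of "j - 1" j _ i] by auto

text \<open>The image of a class keeps its representative: boundaries from filtration \<le> j are
  absorbed by the larger \<open>B_tot i\<close>, and only cosets of \<open>B_tot i\<close>
  remain.\<close>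

lemma H_le_eq: "H_le i j = quot_module (subspace_module (Z_tot i)) (B_tot i)\<lparr>carrier := coset (B_tot i) ` Z_le i j\<rparr>"
proof -
  have sub: "D ` supp_in (cell_le (i - 1) j) \<subseteq> B_tot i"
    unfolding B_tot_def using in_mono(2) by blast
  have "pm.subspace (D ` supp_in (cell_le (i - 1) j))"
    by (intro pmp.linear_subspace_image lin_D subspace_supp_in)
  then have "induced_map (subspace_module (supp_in (cell_all i))) (B_tot i) (\<lambda>x. x)
      (coset (D ` supp_in (cell_le (i - 1) j)) x) = coset (B_tot i) x" for x
    using UN_coset_lin[OF _ subspaces(2)[of i] pm.linear_ident] sub
    by (simp add: induced_map_def)
  then show ?thesis
    unfolding H_le_def H_tot_def H_sub_def free_space_eq cohomology_subspace_module
      carrier_quot_subspace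
    by (simp add: image_image Z_le_def Z_tot_def flip: B_tot_def)
qed

lemma H_d_eq: "H_d i j = quot_module (subspace_module (Z_d i j)) (B_d i j)"
  by (simp add: H_d_def free_space_eq cohomology_subspace_module Z_d_def B_d_def)

text \<open>Anticommutation makes the induced map well defined: \<Phi> (d y) is the coboundary of -
  \<Phi> y.\<close>

lemma H_Phi_coset:
  "H_Phi i j (coset (B_d i j) x) = coset (B_d (i + 1) (j - 2)) (\<Phi> x)"
proof -
  have "\<Phi> ` B_d i j \<subseteq> B_d (i + 1) (j - 2)"
  proof
    fix u assume "u \<in> \<Phi> ` B_d i j"
    then obtain y where y: "y \<in> supp_in (cell (i - 1) j)" "u = \<Phi> (d y)" by (auto simp: B_d_def)
    have "u = d (- \<Phi> y)"
      using anticomm[OF in_mono(4)[OF y(1)]] y(2) by (simp add: d_simps eq_neg_iff_add_eq_0)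
    moreover have "- \<Phi> y \<in> supp_in (cell i (j - 2))"
      using Phi_closed[OF y(1)] pm.subspace_neg[OF subspace_supp_in] by simp
    ultimately show "u \<in> B_d (i + 1) (j - 2)" by (auto simp: B_d_def)
  qed
  then show ?thesis
    using UN_coset_lin[OF subspaces(5)[of i j] subspaces(5)[of "i + 1" "j - 2"] lin_Phi, of x]
    by (simp add: H_Phi_def induced_map_def free_space_eq B_d_def)
qed

text \<open>\<open>p\<close> presents the left side and \<open>q\<close> after \<open>part j\<close>
  the right side as a quotient of \<open>Z_le i j\<close>. Surjectivity of the latter rests on
  \<open>extend_to_cocycle\<close>, equality of fibres on
  \<open>same_leading_class_iff\<close>.\<close>

theorem collapse:
  "\<exists>\<phi>. \<phi> \<in> linear_iso rat_field
    (quot_module (H_le i j) (carrier (H_le i (j - 1))))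
    (cohomology (H_d (i - 1) (j + 2)) (H_Phi (i - 1) (j + 2)) (H_d i j) (H_Phi i j)
      (H_d (i + 1) (j - 2)))"
proof -
  let ?Q = "quot_module (H_le i j) (carrier (H_le i (j - 1)))"
  have L_eq: "?Q = quot_module (quot_module (subspace_module (Z_tot i)) (B_tot i)
      \<lparr>carrier := coset (B_tot i) ` Z_le i j\<rparr>) (coset (B_tot i) ` Z_le i (j - 1))"
    by (simp add: H_le_eq)
  obtain p where p: "module rat_field ?Q" "linear_map rat_field (subspace_module (Z_le i j)) ?Q p"
    "p ` Z_le i j = carrier ?Q"
    and p_eq: "\<forall>x\<in>Z_le i j. \<forall>y\<in>Z_le i j.
      p x = p y \<longleftrightarrow> (\<exists>t\<in>Z_le i (j - 1). x - y - t \<in> B_tot i)"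
    using iterated_quotient[OF subspaces(1) subspaces(3) subspaces(3) subspaces(2)
        Z_le_subset(2) Z_le_subset(1) B_tot_subset L_eq] by (elim exE conjE) (rule that)
  \<comment> \<open>Representatives of the kernel and the image of \<Phi> on cohomology:
    \<open>K\<close> asks that \<Phi> x be a coboundary, not that it vanish.\<close>
  define K where "K = {x \<in> Z_d i j. \<Phi> x \<in> B_d (i + 1) (j - 2)}"
  define I where "I = \<Phi> ` Z_d (i - 1) (j + 2)"
  have sub: "pm.subspace K" "pm.subspace I"
    unfolding K_def I_def
    by (intro subspace_preimage_in pmp.linear_subspace_image subspaces lin_Phi)+
  have IK: "I \<subseteq> K"
  proof
    fix u assume "u \<in> I"
    then obtain w where w: "w \<in> supp_in (cell (i - 1) (j + 2))" "d w = 0" "u = \<Phi> w"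
      by (auto simp: I_def Z_d_def)
    have "u \<in> supp_in (cell i j)" using Phi_closed[OF w(1)] w(3) by simp
    moreover have "d u = 0" "\<Phi> u = 0"
      using anticomm[OF in_mono(4)[OF w(1)]] Phi_Phi[OF in_mono(4)[OF w(1)]] w
      by (simp_all add: Phi_simps)
    ultimately show "u \<in> K" using pm.subspace_0[OF subspaces(5)] by (simp add: K_def Z_d_def)
  qed
  let ?R = "cohomology (H_d (i - 1) (j + 2)) (H_Phi (i - 1) (j + 2)) (H_d i j) (H_Phi i j)
      (H_d (i + 1) (j - 2))"
  have zero: "\<zero>\<^bsub>H_d (i + 1) (j - 2)\<^esub> = B_d (i + 1) (j - 2)"
    by (simp add: H_d_eq quot_module_def)
  have "coset N y = N \<longleftrightarrow> y \<in> N" if "pm.subspace N" for N and y :: "'a \<Rightarrow>\<^sub>0 rat"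
    using coset_eq_iff[OF that, of y 0] by simp
  then have ker: "a_kernel (H_d i j) (H_d (i + 1) (j - 2)) (H_Phi i j) = coset (B_d i j) ` K"
    using subspaces(5)[of "i + 1" "j - 2"]
    by (auto simp: a_kernel_def' zero H_Phi_coset K_def)
      (auto simp: H_d_eq carrier_quot_subspace H_Phi_coset)
  have img: "H_Phi (i - 1) (j + 2) ` carrier (H_d (i - 1) (j + 2)) = coset (B_d i j) ` I"
    using H_Phi_coset[of "i - 1" "j + 2"]
    by (simp add: H_d_eq carrier_quot_subspace image_image I_def)
  have R_eq: "?R = quot_module (quot_module (subspace_module (Z_d i j)) (B_d i j)
      \<lparr>carrier := coset (B_d i j) ` K\<rparr>) (coset (B_d i j) ` I)"
    unfolding cohomology_def ker img by (simp add: H_d_eq)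
  have K_sub: "K \<subseteq> Z_d i j" by (auto simp: K_def)
  obtain q where q: "module rat_field ?R" "linear_map rat_field (subspace_module K) ?R q"
    "q ` K = carrier ?R"
    and q_eq: "\<forall>x\<in>K. \<forall>y\<in>K. q x = q y \<longleftrightarrow> (\<exists>t\<in>I. x - y - t \<in> B_d i j)"
    using iterated_quotient[OF subspaces(4) sub subspaces(5) IK K_sub B_d_subset R_eq]
    by (elim exE conjE) (rule that)
  have part_K: "part j ` Z_le i j = K"
  proof (intro equalityI subsetI)
    fix z assume "z \<in> K"
    then obtain u where "z \<in> supp_in (cell i j)" "d z = 0" "u \<in> supp_in (cell i (j - 2))" "\<Phi> z = d u"
      by (auto simp: K_def Z_d_def B_d_def)
    then obtain x where "x \<in> supp_in (cell_le i j)" "D x = 0" "part j x = z"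
      using extend_to_cocycle by blast
    then show "z \<in> part j ` Z_le i j" by (auto simp: Z_le_def)
  next
    fix z assume "z \<in> part j ` Z_le i j"
    then obtain x where x: "x \<in> supp_in (cell_le i j)" "D x = 0" "z = part j x"
      by (auto simp: Z_le_def)
    have xB: "x \<in> supp_in B" "x \<in> supp_in (cell_all i)" using x(1) in_mono by blast+
    have "d z = 0"
      using part_D[OF xB(1), of j] part_le[OF x(1), of "j + 2"] x by (simp add: Phi_simps part_simps)
    \<comment> \<open>The component of D x = 0 in degree j - 2 exhibits \<Phi> z as a
      coboundary.\<close>
    moreover have "\<Phi> z + d (part (j - 2) x) = 0"
      using part_D[OF xB(1), of "j - 2"] x by (simp add: part_simps)
    then have "\<Phi> z = d (- part (j - 2) x)"
      by (simp add: d_simps eq_neg_iff_add_eq_0)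
    moreover have "- part (j - 2) x \<in> supp_in (cell (i + 1 - 1) (j - 2))"
      using pm.subspace_neg[OF subspace_supp_in part_in_cell[OF xB(2)]] by simp
    ultimately show "z \<in> K"
      using part_in_cell[OF xB(2), of j] x(3) by (auto simp: K_def Z_d_def B_d_def)
  qed
  show ?thesis
  proof (rule linear_iso_if_common_cover[OF p(1) q(1) p(2)])
    show "linear_map rat_field (subspace_module (Z_le i j)) ?R (\<lambda>x. q (part j x))"
      by (rule linear_map_compose[OF linear_map_subspace_module[OF lin_part] q(2)])
        (simp add: part_K)
    show "(\<lambda>x. q (part j x)) ` carrier (subspace_module (Z_le i j)) = carrier ?R"
      using part_K q(3) by (simp flip: image_image)
    fix x y assume "x \<in> carrier (subspace_module (Z_le i j))" "y \<in> carrier (subspace_module (Z_le i j))"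
    then have xy: "x \<in> Z_le i j" "y \<in> Z_le i j" by simp_all
    then have "x - y \<in> Z_le i j" using pm.subspace_diff[OF subspaces(3)] by blast
    then have diff: "x - y \<in> supp_in (cell_le i j)" "D (x - y) = 0" by (auto simp: Z_le_def)
    have "p x = p y \<longleftrightarrow> (\<exists>t\<in>Z_le i (j - 1). x - y - t \<in> B_tot i)"
      using p_eq xy by blast
    also have "\<dots> \<longleftrightarrow> (\<exists>t\<in>supp_in (cell_le i (j - 1)). D t = 0 \<and>
        (\<exists>w\<in>supp_in (cell_all (i - 1)). x - y - t = D w))"
      unfolding Z_le_def B_tot_def by blast
    also have "\<dots> \<longleftrightarrow> (\<exists>w\<in>supp_in (cell (i - 1) (j + 2)). \<exists>y'\<in>supp_in (cell (i - 1) j).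
          d w = 0 \<and> part j (x - y) = \<Phi> w + d y')"
      by (rule same_leading_class_iff[OF diff])
    also have "\<dots> \<longleftrightarrow> (\<exists>t\<in>I. part j x - part j y - t \<in> B_d i j)"
      unfolding I_def Z_d_def B_d_def
      by (simp add: part_simps image_iff Bex_def algebra_simps) blast
    also have "\<dots> \<longleftrightarrow> q (part j x) = q (part j y)"
      using q_eq part_K xy by blast
    finally show "p x = p y \<longleftrightarrow> q (part j x) = q (part j y)" .
  qed (use p(3) subspaces(3) in \<open>simp_all add: pm.subspace_add pm.subspace_scale\<close>)
qed

end

section \<open>Components\<close>

lemma adj_insert:
  "adj G (insert e s) = adj G s \<union> {(fst (ends G e), snd (ends G e)), (snd (ends G e), fst (ends G e))}"
  by (auto simp: adj_def)

lemma adj_mono: "s \<subseteq> s' \<Longrightarrow> adj G s \<subseteq> adj G s'"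
  by (auto simp: adj_def)

lemma sym_adj: "sym (adj G s)"
  by (auto simp: adj_def sym_def)

lemma comp_of_self [simp]: "v \<in> comp_of G s v"
  by (simp add: comp_of_def)

lemma comp_of_sym: "u \<in> comp_of G s v \<Longrightarrow> v \<in> comp_of G s u"
  using symD[OF sym_rtrancl[OF sym_adj]] by (auto simp: comp_of_def)

lemma comp_of_trans: "u \<in> comp_of G s v \<Longrightarrow> w \<in> comp_of G s u \<Longrightarrow> w \<in> comp_of G s v"
  by (auto simp: comp_of_def)

lemma comp_of_eq_iff: "comp_of G s u = comp_of G s v \<longleftrightarrow> u \<in> comp_of G s v"
  using comp_of_sym comp_of_trans comp_of_self by (metis subsetI subset_antisym)

lemma comp_of_eq: "u \<in> comp_of G s v \<Longrightarrow> comp_of G s u = comp_of G s v"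
  by (simp add: comp_of_eq_iff)

lemma comp_of_mono: "s \<subseteq> s' \<Longrightarrow> comp_of G s v \<subseteq> comp_of G s' v"
  unfolding comp_of_def by (intro Image_mono rtrancl_mono adj_mono) auto

lemma comp_of_step:
  assumes "e \<in> s"
  shows "comp_of G s (fst (ends G e)) = comp_of G s (snd (ends G e))"
proof -
  have "(snd (ends G e), fst (ends G e)) \<in> adj G s"
    using assms by (auto simp: adj_def intro: bexI[of _ e])
  then show ?thesis unfolding comp_of_eq_iff by (auto simp: comp_of_def)
qed

text \<open>A path in \<open>F\<close> from \<open>v\<close> to a vertex outside the
  \<open>K\<close>-component of \<open>v\<close> must cross the boundary of that component; the
  crossing edge is returned with its direction.\<close>

lemma comp_of_leave:
  assumes "y \<in> comp_of G F v" "y \<notin> comp_of G K v"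
  obtains e u w where "e \<in> F" "ends G e = (u, w) \<or> ends G e = (w, u)"
    "u \<in> comp_of G K v" "w \<notin> comp_of G K v" "w \<in> comp_of G F v"
proof -
  have "(v, y) \<in> (adj G F)\<^sup>*" using assms(1) by (simp add: comp_of_def)
  then have "y \<notin> comp_of G K v \<Longrightarrow> \<exists>u w. (u, w) \<in> adj G F \<and> u \<in> comp_of G K v \<and>
      w \<notin> comp_of G K v \<and> w \<in> comp_of G F v"
  proof (induction rule: rtrancl_induct)
    case base
    then show ?case by simp
  next
    case (step y z)
    show ?case
    proof (cases "y \<in> comp_of G K v")
      case True
      have "z \<in> comp_of G F v" using step(1,2) by (auto simp: comp_of_def)
      then show ?thesis using True step by blast
    qed (use step in blast)
  qed
  then show ?thesis using assms(2) that by (auto simp: adj_def)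
qed

text \<open>A path in \<open>insert e s\<close> that starts outside the two merged components never uses \<open>e\<close>.\<close>

lemma comp_of_insert:
  fixes G :: "('v, 'e) graph"
  defines "A s e \<equiv> comp_of G s (fst (ends G e)) \<union> comp_of G s (snd (ends G e))"
  shows "comp_of G (insert e s) v = (if v \<in> A s e then A s e else comp_of G s v)"
proof -
  let ?a = "fst (ends G e)" and ?b = "snd (ends G e)" and ?s = "insert e s"
  have sub: "comp_of G s u \<subseteq> comp_of G ?s u" for u by (rule comp_of_mono) auto
  have ab: "comp_of G ?s ?a = comp_of G ?s ?b" by (rule comp_of_step) simp
  then have A_sub: "A s e \<subseteq> comp_of G ?s ?a" using sub unfolding A_def by blast
  \<comment> \<open>A union of components of \<open>s\<close> that contains both ends of
    \<open>e\<close> or neither cannot be left by a path. It is applied to the merged component and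
    to a component that \<open>e\<close> does not touch.\<close>
  have closed: "comp_of G ?s u \<subseteq> W"
    if "u \<in> W" "\<And>x. x \<in> W \<Longrightarrow> comp_of G s x \<subseteq> W" "?a \<in> W \<longleftrightarrow> ?b \<in> W" for u W
  proof
    fix y assume "y \<in> comp_of G ?s u"
    then have "(u, y) \<in> (adj G ?s)\<^sup>*" by (simp add: comp_of_def)
    then show "y \<in> W"
    proof (induction rule: rtrancl_induct)
      case (step y z)
      then consider "(y, z) \<in> adj G s" | "y = ?a" "z = ?b" | "y = ?b" "z = ?a"
        unfolding adj_insert by blast
      then show ?case
      proof cases
        case 1
        then have "z \<in> comp_of G s y" by (auto simp: comp_of_def)
        then show ?thesis using step.IH that(2) by blast
      qed (use step.IH that(3) in auto)
    qed (use that in auto)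
  qed
  have A_closed: "comp_of G s x \<subseteq> A s e" if "x \<in> A s e" for x
    using that comp_of_eq[of x G s] unfolding A_def by (metis Un_iff Un_upper1 Un_upper2)
  show ?thesis
  proof (cases "v \<in> A s e")
    case True
    then have "comp_of G ?s v = comp_of G ?s ?a" using A_sub by (intro comp_of_eq) blast
    moreover have "comp_of G ?s ?a \<subseteq> A s e"
      by (rule closed[OF _ A_closed]) (auto simp: A_def)
    ultimately show ?thesis using A_sub True by auto
  next
    case False
    have "?a \<notin> comp_of G s v" "?b \<notin> comp_of G s v"
      using False comp_of_sym[of _ G s v] unfolding A_def by blast+
    then have "comp_of G ?s v \<subseteq> comp_of G s v"
      by (intro closed) (simp_all add: comp_of_eq)
    then show ?thesis using sub False by auto
  qed
qed

section \<open>Components of a finite multigraph when an edge is added\<close>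

locale finite_multigraph =
  fixes G :: "('v, 'e::linorder) graph"
  assumes finite_graph: "finite_graph G"
begin

abbreviation "V \<equiv> verts G"
abbreviation "E \<equiv> edges G"
abbreviation "cmp \<equiv> comp_of G"
abbreviation "comps \<equiv> graph_components G"
abbreviation "tail e \<equiv> fst (ends G e)"
abbreviation "head e \<equiv> snd (ends G e)"

lemma finite_V: "finite V" and finite_E: "finite E"
  and ends_V: "e \<in> E \<Longrightarrow> tail e \<in> V" "e \<in> E \<Longrightarrow> head e \<in> V"
  using finite_graph by (auto simp: finite_graph_def)

lemma finite_comps: "finite (comps s)"
  using finite_V by (simp add: graph_components_def)

lemma comp_in_comps: "v \<in> V \<Longrightarrow> cmp s v \<in> comps s"
  by (simp add: graph_components_def)

lemma comps_cases: "P \<in> comps s \<Longrightarrow> (\<And>v. v \<in> V \<Longrightarrow> P = cmp s v \<Longrightarrow> thesis) \<Longrightarrow> thesis"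
  by (auto simp: graph_components_def)

lemma comps_eq_comp: "P \<in> comps s \<Longrightarrow> v \<in> P \<Longrightarrow> P = cmp s v"
  by (auto elim!: comps_cases simp: comp_of_eq)

lemma comps_subset_iff:
  assumes "s \<subseteq> s'" "Q \<in> comps s'"
  shows "cmp s v \<subseteq> Q \<longleftrightarrow> v \<in> Q"
proof
  assume "v \<in> Q"
  then have "Q = cmp s' v" by (rule comps_eq_comp[OF assms(2)])
  then show "cmp s v \<subseteq> Q" using comp_of_mono[OF assms(1)] by simp
qed (use comp_of_self[of v G s] in blast)

lemma comps_insert_loop:
  assumes "cmp s (tail e) = cmp s (head e)"
  shows "cmp (insert e s) v = cmp s v" "comps (insert e s) = comps s"
proof -
  show "cmp (insert e s) v = cmp s v" for v
    using assms comp_of_eq[of v G s "head e"] by (simp add: comp_of_insert)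
  then show "comps (insert e s) = comps s" by (simp add: graph_components_def)
qed

text \<open>The loop case is included: the component is then removed and put back.\<close>

lemma comps_insert:
  assumes "e \<in> E"
  shows "comps (insert e s) = comps s - {cmp s (tail e), cmp s (head e)}
    \<union> {cmp s (tail e) \<union> cmp s (head e)}" (is "_ = ?R")
proof (intro equalityI subsetI)
  fix Q assume "Q \<in> comps (insert e s)"
  then obtain v where v: "v \<in> V" "Q = cmp (insert e s) v" by (auto simp: graph_components_def)
  show "Q \<in> ?R"
  proof (cases "v \<in> cmp s (tail e) \<union> cmp s (head e)")
    case False
    then have "cmp s v \<noteq> cmp s (tail e)" "cmp s v \<noteq> cmp s (head e)"
      by (simp_all add: comp_of_eq_iff)
    then show ?thesis using False v comp_in_comps[of v s] by (simp add: comp_of_insert)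
  qed (use v in \<open>auto simp: comp_of_insert\<close>)
next
  fix Q assume Q: "Q \<in> ?R"
  show "Q \<in> comps (insert e s)"
  proof (cases "Q = cmp s (tail e) \<union> cmp s (head e)")
    case True
    then have "Q = cmp (insert e s) (tail e)" by (simp add: comp_of_insert)
    then show ?thesis using comp_in_comps ends_V(1)[OF assms] by simp
  next
    case False
    then have "Q \<in> comps s" and ne: "Q \<noteq> cmp s (tail e)" "Q \<noteq> cmp s (head e)" using Q by blast+
    then obtain v where v: "v \<in> V" "Q = cmp s v" by (auto simp: graph_components_def)
    have "v \<notin> cmp s (tail e) \<union> cmp s (head e)"
      using v ne by (simp add: comp_of_eq_iff)
    then have "Q = cmp (insert e s) v" using v by (simp add: comp_of_insert)
    then show ?thesis using comp_in_comps v by simp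
  qed
qed

text \<open>Guarantees that the merged component is a fresh key of the labelling, so writing its
  label overwrites nothing.\<close>

lemma union_not_comp:
  assumes "cmp s a \<noteq> cmp s b"
  shows "cmp s a \<union> cmp s b \<notin> comps s"
proof
  assume "cmp s a \<union> cmp s b \<in> comps s"
  then have "cmp s a \<union> cmp s b = cmp s a" "cmp s a \<union> cmp s b = cmp s b"
    by (rule comps_eq_comp, simp)+
  then show False using assms by simp
qed

lemma card_comps_insert:
  assumes "e \<in> E" "cmp s (tail e) \<noteq> cmp s (head e)"
  shows "int (card (comps (insert e s))) = int (card (comps s)) - 1"
proof -
  let ?A = "cmp s (tail e)" and ?B = "cmp s (head e)"
  have "?A \<in> comps s" "?B \<in> comps s" by (simp_all add: ends_V assms(1) comp_in_comps)
  then have "card (comps s - {?A, ?B}) = card (comps s) - 2" "2 \<le> card (comps s)"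
    using assms(2) finite_comps card_mono[of "comps s" "{?A, ?B}"] by (auto simp: card_Diff_subset)
  then show ?thesis
    using comps_insert[OF assms(1), of s] union_not_comp[OF assms(2)] finite_comps[of s]
    by (simp add: card_insert_if)
qed

end

context finite_multigraph
begin

section \<open>The total differential\<close>

lemma estate_iff: "S \<in> estates G \<longleftrightarrow> fst S \<subseteq> E \<and> dom (snd S) = comps (fst S)"
  by (cases S) (simp add: estates_def)

lemma estate_dom: "S \<in> estates G \<Longrightarrow> dom (snd S) = comps (fst S)"
  and estate_edges: "S \<in> estates G \<Longrightarrow> fst S \<subseteq> E"
  by (simp_all add: estate_iff)

lemma estate_component:
  assumes "S \<in> estates G" "snd S P = Some c"
  shows "\<exists>v\<in>V. P = cmp (fst S) v"
proof -
  have "P \<in> comps (fst S)" using estate_dom[OF assms(1)] assms(2) by blast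
  then show ?thesis by (auto simp: graph_components_def)
qed

lemma estates_finite_x:
  assumes "S \<in> estates G"
  shows "finite {P. snd S P = Some LX}" "{P. snd S P = Some LX} \<subseteq> comps (fst S)"
proof -
  show *: "{P. snd S P = Some LX} \<subseteq> comps (fst S)"
    using estate_dom[OF assms] by (auto simp: dom_def)
  show "finite {P. snd S P = Some LX}"
    by (rule finite_subset[OF * finite_comps])
qed

text \<open>Since merging two labels \<open>x\<close> gives \<open>0\<close> under \<open>d\<close> and
  \<open>1\<close> under \<open>\<Phi>\<close>, the sum \<open>\<Phi> + d\<close> multiplies labels in \<open>\<rat>[x]/(x^2 - 1)\<close>, that is, adds parities.\<close>

definition par :: "('v, 'e) estate \<Rightarrow> 'e set \<Rightarrow> ('v, 'e) estate" where
  "par S s' = (s', \<lambda>Q. if Q \<in> comps s'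
     then Some (if odd (card {P. snd S P = Some LX \<and> P \<subseteq> Q}) then LX else LOne) else None)"

lemma fst_par [simp]: "fst (par S s') = s'"
  by (simp add: par_def)

lemma par_in_estates: "s' \<subseteq> E \<Longrightarrow> par S s' \<in> estates G"
  by (auto simp: par_def estates_def dom_def)

text \<open>Parity is additive: the components of \<open>S\<close> inside a component of
  \<open>s''\<close> are sorted by the components of \<open>s'\<close>, and a sum is odd iff it has
  an odd number of odd summands. Thus only the final edge set matters, not the order of
  insertion.\<close>

lemma par_par:
  assumes S: "S \<in> estates G" and sub: "fst S \<subseteq> s'" "s' \<subseteq> s''"
  shows "par (par S s') s'' = par S s''"
proof -
  have "odd (card {Q. snd (par S s') Q = Some LX \<and> Q \<subseteq> R}) \<longleftrightarrow>
      odd (card {P. snd S P = Some LX \<and> P \<subseteq> R})" if R: "R \<in> comps s''" for R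
  proof -
    let ?N = "\<lambda>Q. {P. snd S P = Some LX \<and> P \<subseteq> Q}"
    let ?I = "{Q \<in> comps s'. Q \<subseteq> R}"
    have "?N R = (\<Union>Q\<in>?I. ?N Q)"
    proof (intro equalityI subsetI)
      fix P assume P: "P \<in> ?N R"
      then obtain v where v: "v \<in> V" "P = cmp (fst S) v"
        using estate_component[OF S] by blast
      then have "v \<in> R" using P by auto
      then have "cmp s' v \<subseteq> R" using comps_subset_iff[OF sub(2) R] by simp
      then show "P \<in> (\<Union>Q\<in>?I. ?N Q)"
        using P v comp_in_comps[OF v(1)] comp_of_mono[OF sub(1), of G v]
        by (intro UN_I[of "cmp s' v"]) auto
    qed auto
    moreover have "card (\<Union>Q\<in>?I. ?N Q) = (\<Sum>Q\<in>?I. card (?N Q))"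
    proof (rule card_UN_disjoint)
      show "\<forall>Q\<in>?I. \<forall>Q'\<in>?I. Q \<noteq> Q' \<longrightarrow> ?N Q \<inter> ?N Q' = {}"
      proof (intro ballI impI)
        fix Q Q' assume Q: "Q \<in> ?I" "Q' \<in> ?I" "Q \<noteq> Q'"
        have False if P: "P \<in> ?N Q \<inter> ?N Q'" for P
        proof -
          obtain v where "P = cmp (fst S) v"
            using P estate_component[OF S] by blast
          then have v: "v \<in> Q" "v \<in> Q'" using P by auto
          have "Q = cmp s' v" "Q' = cmp s' v" using Q v by (auto intro!: comps_eq_comp)
          then show False using Q(3) by simp
        qed
        then show "?N Q \<inter> ?N Q' = {}" by blast
      qed
    qed (use finite_comps estates_finite_x(1)[OF S] in auto)
    moreover have "{Q. snd (par S s') Q = Some LX \<and> Q \<subseteq> R} = {Q \<in> ?I. odd (card (?N Q))}"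
      by (auto simp: par_def split: if_splits)
    ultimately show ?thesis
      using even_sum_iff[of ?I "\<lambda>Q. card (?N Q)"] finite_comps by simp
  qed
  then show ?thesis
    by (subst (1 3) par_def) (auto simp: fun_eq_iff)
qed

definition merge :: "('v, 'e) estate \<Rightarrow> 'e \<Rightarrow> label \<Rightarrow> ('v, 'e) estate" where
  "merge S e c = (insert e (fst S),
    merge_labels (snd S) (cmp (fst S) (tail e)) (cmp (fst S) (head e)) c)"

lemma estate_label:
  assumes "S \<in> estates G" "v \<in> V"
  obtains c where "snd S (cmp (fst S) v) = Some c"
  using comp_in_comps[OF assms(2), of "fst S"] estate_dom[OF assms(1)] that by auto

lemma merge_in_estates:
  assumes "S \<in> estates G" "e \<in> E"
  shows "merge S e c \<in> estates G"
  unfolding estate_iff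
proof
  show "fst (merge S e c) \<subseteq> E" using assms estate_edges[OF assms(1)] by (simp add: merge_def)
  show "dom (snd (merge S e c)) = comps (fst (merge S e c))"
    using comps_insert[OF assms(2), of "fst S"] estate_dom[OF assms(1)]
    by (auto simp: merge_def merge_labels_def)
qed

lemma loop_in_estates:
  assumes "S \<in> estates G" "e \<in> E" "cmp (fst S) (tail e) = cmp (fst S) (head e)"
  shows "(insert e (fst S), snd S) \<in> estates G"
  using assms comps_insert_loop(2)[OF assms(3)] estate_dom[OF assms(1)] estate_edges[OF assms(1)]
  by (simp add: estate_iff)

lemma merge_x:
  assumes S: "S \<in> estates G" and "cmp (fst S) (tail e) \<noteq> cmp (fst S) (head e)"
  shows "{P. snd (merge S e c) P = Some LX} =
    {P. snd S P = Some LX} - {cmp (fst S) (tail e), cmp (fst S) (head e)} \<union>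
    (if c = LX then {cmp (fst S) (tail e) \<union> cmp (fst S) (head e)} else {})"
  using union_not_comp[OF assms(2)] estates_finite_x(2)[OF S]
  by (auto simp: merge_def merge_labels_def split: if_splits)

lemma state_deg_merge:
  assumes S: "S \<in> estates G" and e: "e \<in> E" and ne: "cmp (fst S) (tail e) \<noteq> cmp (fst S) (head e)"
    and ab: "snd S (cmp (fst S) (tail e)) = Some a" "snd S (cmp (fst S) (head e)) = Some b"
  shows "state_deg (merge S e c) = state_deg S - (if a = LX then 1 else 0) - (if b = LX then 1 else 0)
    + (if c = LX then 1 else 0)"
proof -
  let ?A = "cmp (fst S) (tail e)" and ?B = "cmp (fst S) (head e)"
  let ?N = "{P. snd S P = Some LX}"
  have fin: "finite ?N" by (rule estates_finite_x(1)[OF S])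
  have "int (card (?N - {?A, ?B})) =
      int (card ?N) - (if a = LX then 1 else 0) - (if b = LX then 1 else 0)"
  proof -
    have "?N - {?A, ?B} = ?N - {?A} - {?B}" by auto
    moreover have "?A \<in> ?N \<longleftrightarrow> a = LX" "?B \<in> ?N - {?A} \<longleftrightarrow> b = LX" using ab ne by auto
    moreover have "int (card (M - {P})) = int (card M) - (if P \<in> M then 1 else 0)"
      if M: "finite M" for M and P :: "'v set"
      using card_Suc_Diff1[OF M, of P] by (cases "P \<in> M") auto
    ultimately show ?thesis
      using fin by (simp only: finite_Diff)
  qed
  moreover have "?A \<union> ?B \<notin> ?N - {?A, ?B}"
    using union_not_comp[OF ne] estates_finite_x(2)[OF S] by auto
  ultimately show ?thesis
    unfolding state_deg_def merge_x[OF S ne] using fin by (auto simp: card_insert_if)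
qed

lemma T_edge_loop:
  "cmp (fst S) (tail e) = cmp (fst S) (head e) \<Longrightarrow>
    T_edge G S e = Poly_Mapping.single (insert e (fst S), snd S) 1"
  by (simp add: T_edge_def Let_def)

lemma T_edge_merge:
  assumes "cmp (fst S) (tail e) \<noteq> cmp (fst S) (head e)"
    and "snd S (cmp (fst S) (tail e)) = Some a" "snd S (cmp (fst S) (head e)) = Some b"
  shows "T_edge G S e = (case label_mult a b of None \<Rightarrow> 0 | Some c \<Rightarrow> Poly_Mapping.single (merge S e c) 1)"
  using assms by (cases "label_mult a b") (simp_all add: T_edge_def Let_def merge_def)

lemma U_edge_loop:
  "cmp (fst S) (tail e) = cmp (fst S) (head e) \<Longrightarrow> U_edge G S e = 0"
  by (simp add: U_edge_def Let_def)

lemma U_edge_merge: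
  assumes "cmp (fst S) (tail e) \<noteq> cmp (fst S) (head e)"
    and "snd S (cmp (fst S) (tail e)) = Some a" "snd S (cmp (fst S) (head e)) = Some b"
  shows "U_edge G S e = (if a = LX \<and> b = LX then Poly_Mapping.single (merge S e LOne) 1 else 0)"
  using assms by (simp add: U_edge_def Let_def merge_def)

definition cell :: "int \<Rightarrow> int \<Rightarrow> ('v, 'e) estate set" where
  "cell i j = {S \<in> estates G. state_dim S = i \<and> state_deg S = j}"

lemma state_dim_insert:
  assumes "S \<in> estates G" "e \<in> E - fst S" "fst S' = insert e (fst S)"
  shows "state_dim S' = state_dim S + 1"
proof -
  have "finite (fst S)" using estate_edges[OF assms(1)] finite_E finite_subset by auto
  then show ?thesis using assms by (simp add: state_dim_def)
qed

lemma label_exhaust_pair: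
  obtains "a = LOne" "b = LOne" | "a = LOne" "b = LX" | "a = LX" "b = LOne" | "a = LX" "b = LX"
  by (cases a; cases b) auto

text \<open>A nonzero product in Q[x]/(x^2) has as many x as its factors together, while \<Phi>
  replaces two x by 1.\<close>

lemma edge_maps_in_cell:
  assumes S: "S \<in> estates G" and e: "e \<in> E - fst S"
  shows "T_edge G S e \<in> supp_in (cell (state_dim S + 1) (state_deg S))"
    "U_edge G S e \<in> supp_in (cell (state_dim S + 1) (state_deg S - 2))"
proof -
  have eE: "e \<in> E" using e by simp
  have zero: "0 \<in> supp_in W" for W :: "('v, 'e) estate set"
    by (simp add: supp_in_def)
  have "T_edge G S e \<in> supp_in (cell (state_dim S + 1) (state_deg S)) \<and>
    U_edge G S e \<in> supp_in (cell (state_dim S + 1) (state_deg S - 2))"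
  proof (cases "cmp (fst S) (tail e) = cmp (fst S) (head e)")
    case True
    show ?thesis
      using zero loop_in_estates[OF S eE True] state_dim_insert[OF S e, of "(insert e (fst S), snd S)"]
      by (auto simp: T_edge_loop[OF True] U_edge_loop[OF True] cell_def state_deg_def
          intro!: single_in_supp_in)
  next
    case False
    obtain a b where ab: "snd S (cmp (fst S) (tail e)) = Some a" "snd S (cmp (fst S) (head e)) = Some b"
      using estate_label[OF S] ends_V[OF eE] by metis
    have "merge S e c \<in> cell (state_dim S + 1) (state_deg S - (if a = LX then 1 else 0) - (if b = LX then 1 else 0)
      + (if c = LX then 1 else 0))" for c
      using merge_in_estates[OF S eE] state_deg_merge[OF S eE False ab]
        state_dim_insert[OF S e, of "merge S e c"]
      by (simp add: cell_def merge_def)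
    note m = this[of LX] this[of LOne]
    show ?thesis
      unfolding T_edge_merge[OF False ab] U_edge_merge[OF False ab]
      by (cases rule: label_exhaust_pair[of a b]) (use zero m in \<open>auto intro!: single_in_supp_in\<close>)
  qed
  then show "T_edge G S e \<in> supp_in (cell (state_dim S + 1) (state_deg S))"
    "U_edge G S e \<in> supp_in (cell (state_dim S + 1) (state_deg S - 2))" by auto
qed

lemma par_eqI:
  assumes "S \<in> estates G" "S' \<in> estates G" "fst S' = s'"
    and "\<And>Q. Q \<in> comps s' \<Longrightarrow>
      snd S' Q = Some (if odd (card {P. snd S P = Some LX \<and> P \<subseteq> Q}) then LX else LOne)"
  shows "S' = par S s'"
proof -
  have "snd S' Q = None" if "Q \<notin> comps s'" for Q
    using estate_dom[OF assms(2)] that assms(3) by auto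
  then show ?thesis
    using assms(3,4) by (cases S') (auto simp: par_def fun_eq_iff)
qed

text \<open>The two terms are never both nonzero: \<Phi> contributes exactly when both merged labels
  are x, which is where \<open>d\<close> gives 0. So one basis state survives for every edge, and
  its labels are parities.\<close>

lemma T_edge_plus_U_edge:
  assumes S: "S \<in> estates G" and e: "e \<in> E - fst S"
  shows "U_edge G S e + T_edge G S e = Poly_Mapping.single (par S (insert e (fst S))) 1"
proof -
  let ?s = "fst S"
  let ?A = "cmp ?s (tail e)" and ?B = "cmp ?s (head e)"
  have eE: "e \<in> E" using e by simp
  \<comment> \<open>Distinct components are never nested, so inside a component of \<open>S\<close>
    itself the count is 0 or 1 and reproduces the old label.\<close>
  have old: "{P. snd S P = Some LX \<and> P \<subseteq> Q} = (if snd S Q = Some LX then {Q} else {})"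
    if Qc: "Q \<in> comps ?s" for Q
  proof -
    have "P = Q" if P: "snd S P = Some LX" "P \<subseteq> Q" for P
    proof -
      obtain v where v: "P = cmp ?s v" using P estate_component[OF S] by blast
      then have "v \<in> Q" using P(2) by auto
      then show ?thesis using comps_eq_comp[OF Qc] v by simp
    qed
    then show ?thesis by auto
  qed
  have lab: "snd S Q = Some (if odd (card {P. snd S P = Some LX \<and> P \<subseteq> Q}) then LX else LOne)"
    if Qc: "Q \<in> comps ?s" for Q
  proof -
    obtain c where "snd S Q = Some c" using Qc estate_dom[OF S] by auto
    then show ?thesis unfolding old[OF Qc] by (cases c) auto
  qed
  show ?thesis
  proof (cases "?A = ?B")
    case True
    have "(insert e ?s, snd S) = par S (insert e ?s)"
      by (rule par_eqI[OF S loop_in_estates[OF S eE True]])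
        (use lab comps_insert_loop[OF True] in auto)
    then show ?thesis by (simp add: T_edge_loop[OF True] U_edge_loop[OF True])
  next
    case False
    obtain a b where ab: "snd S ?A = Some a" "snd S ?B = Some b"
      using estate_label[OF S] ends_V[OF eE] by metis
    have AB: "{P. snd S P = Some LX \<and> P \<subseteq> ?A \<union> ?B} =
        (if a = LX then {?A} else {}) \<union> (if b = LX then {?B} else {})"
    proof -
      have "P = ?A \<or> P = ?B" if P: "snd S P = Some LX" "P \<subseteq> ?A \<union> ?B" for P
      proof -
        obtain v where v: "P = cmp ?s v" using P estate_component[OF S] by blast
        then have "v \<in> ?A \<union> ?B" using P(2) by auto
        then show ?thesis unfolding v comp_of_eq_iff by blast
      qed
      then have "{P. snd S P = Some LX \<and> P \<subseteq> ?A \<union> ?B} = {P \<in> {?A, ?B}. snd S P = Some LX}"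
        by blast
      then show ?thesis using ab by auto
    qed
    have merge_par: "merge S e c = par S (insert e ?s)" if "c = LX \<longleftrightarrow> a \<noteq> b" for c
    proof (rule par_eqI[OF S merge_in_estates[OF S eE]])
      fix Q assume "Q \<in> comps (insert e ?s)"
      then consider "Q = ?A \<union> ?B" | "Q \<in> comps ?s" "Q \<noteq> ?A" "Q \<noteq> ?B"
        unfolding comps_insert[OF eE] by blast
      then show "snd (merge S e c) Q = Some (if odd (card {P. snd S P = Some LX \<and> P \<subseteq> Q}) then LX else LOne)"
      proof cases
        case 1
        show ?thesis
          unfolding 1 AB using that False
          by (cases a; cases b; cases c) (auto simp: merge_def merge_labels_def)
      next
        case 2
        then have "Q \<noteq> ?A \<union> ?B" using union_not_comp[OF False] by blast
        then have "snd (merge S e c) Q = snd S Q" using 2 by (simp add: merge_def merge_labels_def)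
        then show ?thesis using lab[OF 2(1)] by simp
      qed
    qed (simp add: merge_def)
    show ?thesis
      unfolding T_edge_merge[OF False ab] U_edge_merge[OF False ab]
      by (cases rule: label_exhaust_pair[of a b]) (auto simp: merge_par)
  qed
qed

section \<open>The squares of the differentials vanish\<close>

lemma lin_chrom_d: "lin (chrom_d G)" and lin_Phi: "lin (Phi G)"
  unfolding chrom_d_def Phi_def by (rule lin_linear_ext)+

lemma lin_Phi_d: "lin (Phi_d G)"
  unfolding Phi_d_def by (rule pmp.linear_compose_add[OF lin_Phi lin_chrom_d])

lemma chrom_d_single: "chrom_d G (Poly_Mapping.single S 1) =
    (\<Sum>e\<in>E - fst S. scale (edge_sign (fst S) e) (T_edge G S e))"
  by (simp add: chrom_d_def)

lemma Phi_single: "Phi G (Poly_Mapping.single S 1) =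
    (\<Sum>e\<in>E - fst S. scale (edge_sign (fst S) e) (U_edge G S e))"
  by (simp add: Phi_def)

lemma Phi_d_single:
  assumes "S \<in> estates G"
  shows "Phi_d G (Poly_Mapping.single S 1) =
    (\<Sum>e\<in>E - fst S. scale (edge_sign (fst S) e) (Poly_Mapping.single (par S (insert e (fst S))) 1))"
  unfolding Phi_d_def chrom_d_single Phi_single
  using T_edge_plus_U_edge[OF assms]
  by (simp flip: sum.distrib pm.scale_right_distrib)

text \<open>Exactly one of two distinct edges is the smaller one, and inserting it flips the sign of
  the larger.\<close>

lemma edge_sign_insert:
  assumes "finite s" "e \<notin> s" "f \<notin> s" "e \<noteq> f"
  shows "edge_sign s e * edge_sign (insert e s) f = - (edge_sign s f * edge_sign (insert f s) e)"
proof -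
  have *: "edge_sign (insert e s) f = (if e < f then - 1 else 1) * edge_sign s f"
    if "e \<notin> s" for e f
  proof -
    have "{x \<in> insert e s. x < f} = (if e < f then insert e {x \<in> s. x < f} else {x \<in> s. x < f})"
      by auto
    then show ?thesis using that assms(1) by (simp add: edge_sign_def)
  qed
  show ?thesis using *[OF assms(2), of f] *[OF assms(3), of e] assms(4) by auto
qed

lemma antisymmetric_double_sum_eq_0:
  fixes h :: "'c \<Rightarrow> 'c \<Rightarrow> ('a \<Rightarrow>\<^sub>0 rat)"
  assumes "finite A" "\<And>e f. e \<in> A \<Longrightarrow> f \<in> A \<Longrightarrow> e \<noteq> f \<Longrightarrow> h e f = - h f e"
  shows "(\<Sum>e\<in>A. \<Sum>f\<in>A - {e}. h e f) = 0"
proof -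
  let ?h = "\<lambda>e f. if e = f then 0 else h e f"
  have off: "(\<Sum>e\<in>A. \<Sum>f\<in>A - {e}. h e f) = (\<Sum>e\<in>A. \<Sum>f\<in>A. ?h e f)"
    using assms(1) by (intro sum.cong refl sum.mono_neutral_cong_left) auto
  have "(\<Sum>e\<in>A. \<Sum>f\<in>A. ?h e f) = (\<Sum>e\<in>A. \<Sum>f\<in>A. ?h f e)"
    by (rule sum.swap)
  also have "\<dots> = (\<Sum>e\<in>A. \<Sum>f\<in>A. - ?h e f)"
  proof (intro sum.cong refl)
    fix e f assume "e \<in> A" "f \<in> A"
    then show "?h f e = - ?h e f" using assms(2)[of f e] by simp
  qed
  also have "\<dots> = - (\<Sum>e\<in>A. \<Sum>f\<in>A. ?h e f)" by (simp only: sum_negf)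
  finally have neg: "(\<Sum>e\<in>A. \<Sum>f\<in>A - {e}. h e f) = - (\<Sum>e\<in>A. \<Sum>f\<in>A - {e}. h e f)"
    unfolding off .
  show ?thesis
  \<comment> \<open>The sum equals its own negative; comparing coefficients reduces this to
    rationals, where it forces zero.\<close>
  proof (rule poly_mapping_eqI)
    fix k
    show "Poly_Mapping.lookup (\<Sum>e\<in>A. \<Sum>f\<in>A - {e}. h e f) k = Poly_Mapping.lookup 0 k"
      using arg_cong[OF neg, of "\<lambda>x. Poly_Mapping.lookup x k"]
      by (simp only: lookup_uminus lookup_zero equal_neg_zero)
  qed
qed

text \<open>Adding \<open>e\<close> then \<open>f\<close>, or \<open>f\<close> then
  \<open>e\<close>, ends in the same parity state, with opposite signs, so the terms cancel in
  pairs.\<close>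

lemma Phi_d_Phi_d_single:
  assumes S: "S \<in> estates G"
  shows "Phi_d G (Phi_d G (Poly_Mapping.single S 1)) = 0"
proof -
  let ?s = "fst S"
  let ?h = "\<lambda>e f. scale (edge_sign ?s e * edge_sign (insert e ?s) f)
      (Poly_Mapping.single (par S (insert f (insert e ?s))) 1)"
  have sE: "?s \<subseteq> E" and fin: "finite ?s"
    using estate_edges[OF S] finite_E finite_subset by auto
  have "Phi_d G (Poly_Mapping.single (par S (insert e ?s)) 1) =
      (\<Sum>f\<in>E - ?s - {e}. scale (edge_sign (insert e ?s) f)
        (Poly_Mapping.single (par S (insert f (insert e ?s))) 1))" if "e \<in> E - ?s" for e
  proof -
    have "E - insert e ?s = E - ?s - {e}" by auto
    moreover have "par (par S (insert e ?s)) (insert f (insert e ?s)) = par S (insert f (insert e ?s))" for f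
      by (rule par_par[OF S]) auto
    ultimately show ?thesis
      using Phi_d_single[OF par_in_estates[of "insert e ?s" S]] that sE by simp
  qed
  then have "Phi_d G (Phi_d G (Poly_Mapping.single S 1)) = (\<Sum>e\<in>E - ?s. \<Sum>f\<in>E - ?s - {e}. ?h e f)"
    unfolding Phi_d_single[OF S]
    by (simp add: pmp.linear_sum[OF lin_Phi_d] pmp.linear_scale[OF lin_Phi_d] pm.scale_sum_right)
  also have "\<dots> = 0"
  proof (rule antisymmetric_double_sum_eq_0)
    fix e f assume "e \<in> E - ?s" "f \<in> E - ?s" "e \<noteq> f"
    then have "edge_sign ?s e * edge_sign (insert e ?s) f = - (edge_sign ?s f * edge_sign (insert f ?s) e)"
      using edge_sign_insert[OF fin] by blast
    then show "?h e f = - ?h f e"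
      by (simp add: insert_commute)
  qed (use finite_E in simp)
  finally show ?thesis .
qed

lemma sum_edges_in:
  assumes "\<And>e. e \<in> E - fst S \<Longrightarrow> h e \<in> supp_in W"
  shows "(\<Sum>e\<in>E - fst S. scale (c e) (h e)) \<in> supp_in W"
  by (intro pm.subspace_sum[OF subspace_supp_in] pm.subspace_scale[OF subspace_supp_in] assms)

lemma chrom_d_closed:
  assumes "f \<in> supp_in (cell i j)"
  shows "chrom_d G f \<in> supp_in (cell (i + 1) j)"
  by (rule lin_supp_in_image[OF lin_chrom_d assms subspace_supp_in], unfold chrom_d_single, rule sum_edges_in)
    (use edge_maps_in_cell(1) in \<open>auto simp: cell_def\<close>)

lemma Phi_closed:
  assumes "f \<in> supp_in (cell i j)"
  shows "Phi G f \<in> supp_in (cell (i + 1) (j - 2))"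
  by (rule lin_supp_in_image[OF lin_Phi assms subspace_supp_in], unfold Phi_single, rule sum_edges_in)
    (use edge_maps_in_cell(2) in \<open>auto simp: cell_def\<close>)

text \<open>The three expressions live in the degree of \<open>S\<close> lowered by 0, 2 and 4;
  projecting (\<Phi> + d)^2 = 0 to each of these degrees separates them.\<close>

lemma square_components_single:
  assumes S: "S \<in> estates G"
  defines "\<sigma> \<equiv> Poly_Mapping.single S 1"
  shows "chrom_d G (chrom_d G \<sigma>) = 0" "Phi G (chrom_d G \<sigma>) + chrom_d G (Phi G \<sigma>) = 0"
    "Phi G (Phi G \<sigma>) = 0"
proof -
  let ?i = "state_dim S" and ?j = "state_deg S"
  have \<sigma>: "\<sigma> \<in> supp_in (cell ?i ?j)"
    unfolding \<sigma>_def by (rule single_in_supp_in) (simp add: S cell_def)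
  let ?a = "chrom_d G (chrom_d G \<sigma>)" and ?b = "Phi G (chrom_d G \<sigma>) + chrom_d G (Phi G \<sigma>)"
    and ?c = "Phi G (Phi G \<sigma>)"
  have a: "?a \<in> supp_in (cell (?i + 1 + 1) ?j)"
    by (intro chrom_d_closed \<sigma>)
  have b: "?b \<in> supp_in (cell (?i + 1 + 1) (?j - 2))"
    by (intro pm.subspace_add[OF subspace_supp_in] chrom_d_closed Phi_closed \<sigma>)
  have c: "?c \<in> supp_in (cell (?i + 1 + 1) (?j - 2 - 2))"
    by (intro Phi_closed \<sigma>)
  have sum: "?a + ?b + ?c = 0"
    using Phi_d_Phi_d_single[OF S] unfolding Phi_d_def \<sigma>_def
    by (simp add: pmp.linear_add[OF lin_Phi] pmp.linear_add[OF lin_chrom_d] algebra_simps)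
  let ?r = "\<lambda>k. restr {S. state_deg S = k}"
  have r: "?r k f = (if k = j then f else 0)" if "f \<in> supp_in (cell i j)" for f i j k
    using that by (auto simp: cell_def intro!: restr_idem restr_disjoint elim: supp_in_mono)
  have "?r k ?a + ?r k ?b + ?r k ?c = 0" for k
    using arg_cong[OF sum, of "?r k"] by (simp add: restr_add restr_0)
  from this[of ?j] this[of "?j - 2"] this[of "?j - 2 - 2"]
  show "?a = 0" "?b = 0" "?c = 0"
    by (simp_all add: r[OF a] r[OF b] r[OF c] restr_0)
qed

lemma square_components:
  assumes "f \<in> supp_in (estates G)"
  shows "chrom_d G (chrom_d G f) = 0" "Phi G (chrom_d G f) + chrom_d G (Phi G f) = 0"
    "Phi G (Phi G f) = 0"
proof -
  note lc = lin_compose[OF lin_chrom_d lin_chrom_d] lin_compose[OF lin_chrom_d lin_Phi]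
    lin_compose[OF lin_Phi lin_chrom_d] lin_compose[OF lin_Phi lin_Phi]
  note eq = lin_eq_on_supp_in[OF _ pmp.linear_zero assms]
  show "chrom_d G (chrom_d G f) = 0"
    by (rule eq[OF lc(1)]) (rule square_components_single)
  show "Phi G (chrom_d G f) + chrom_d G (Phi G f) = 0"
    by (rule eq[OF pmp.linear_compose_add[OF lc(2,3)]]) (rule square_components_single)
  show "Phi G (Phi G f) = 0"
    by (rule eq[OF lc(4)]) (rule square_components_single)
qed

end

section \<open>Subquotient complexes spanned by basis elements\<close>

locale graded_differential =
  fixes d :: "('a \<Rightarrow>\<^sub>0 rat) \<Rightarrow> ('a \<Rightarrow>\<^sub>0 rat)" and level :: "int \<Rightarrow> 'a set"
  assumes lin_d: "lin d"
    and d_level: "\<And>f i. f \<in> supp_in (level i) \<Longrightarrow> d f \<in> supp_in (level (i + 1))"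
begin

text \<open>\<open>W\<close> stands for a subquotient whose differential is \<open>d\<close>
  followed by projection to the span of \<open>W\<close>. The square of that map vanishes only for
  suitable \<open>W\<close>, hence a predicate.\<close>

definition is_complex :: "'a set \<Rightarrow> bool" where
  "is_complex W \<longleftrightarrow> (\<forall>f\<in>supp_in W. restr W (d (restr W (d f))) = 0)"

text \<open>Makes \<open>Y\<close> the basis of a subcomplex of \<open>Y \<union> Z\<close> and
  \<open>Z\<close> the basis of the quotient by it.\<close>

definition no_arrows :: "'a set \<Rightarrow> 'a set \<Rightarrow> bool" where
  "no_arrows Y Z \<longleftrightarrow> (\<forall>f\<in>supp_in Y. restr Z (d f) = 0)"

definition acyclic_at :: "'a set \<Rightarrow> int \<Rightarrow> bool" where
  "acyclic_at W i \<longleftrightarrow> (\<forall>f\<in>supp_in (W \<inter> level i). restr W (d f) = 0 \<longrightarrow>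
    (\<exists>g\<in>supp_in (W \<inter> level (i - 1)). restr W (d g) = f))"

lemma no_arrowsI:
  assumes "\<And>S. S \<in> Y \<Longrightarrow> restr Z (d (Poly_Mapping.single S 1)) = 0"
  shows "no_arrows Y Z"
  unfolding no_arrows_def
  using lin_eq_on_supp_in[OF lin_compose[OF lin_d lin_restr] pmp.linear_zero] assms by blast

lemma restr_d_level:
  assumes "f \<in> supp_in (W \<inter> level (i - 1))"
  shows "restr Y (d f) \<in> supp_in (Y \<inter> level i)"
proof -
  have "f \<in> supp_in (level (i - 1))" using assms by (rule supp_in_mono) simp
  then have "d f \<in> supp_in (level i)" using d_level[of f "i - 1"] by simp
  then show ?thesis by (rule restr_in_Int)
qed

context
  fixes Y Z :: "'a set"
  assumes disj: "Y \<inter> Z = {}" and arrows: "no_arrows Y Z" and complex: "is_complex (Y \<union> Z)"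
begin

lemma restr_d_sub: "f \<in> supp_in Y \<Longrightarrow> restr (Y \<union> Z) (d f) = restr Y (d f)"
  using arrows by (simp add: restr_Un[OF disj] no_arrows_def)

lemma restr_quot: "restr Z f = restr Z (restr (Y \<union> Z) f)" "restr Y f = restr Y (restr (Y \<union> Z) f)"
  by (simp_all add: restr_restr Int_absorb2)

lemma is_complex_sub: "is_complex Y"
  unfolding is_complex_def
proof
  fix f assume f: "f \<in> supp_in Y"
  then have "f \<in> supp_in (Y \<union> Z)" by (rule supp_in_mono) simp
  then have "restr (Y \<union> Z) (d (restr (Y \<union> Z) (d f))) = 0"
    using complex by (simp add: is_complex_def)
  then show "restr Y (d (restr Y (d f))) = 0"
    using restr_quot(2)[of "d (restr Y (d f))"] by (simp add: restr_d_sub[OF f] restr_0)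
qed

lemma is_complex_quot: "is_complex Z"
  unfolding is_complex_def
proof
  fix f assume f: "f \<in> supp_in Z"
  then have "f \<in> supp_in (Y \<union> Z)" by (rule supp_in_mono) simp
  then have "restr (Y \<union> Z) (d (restr (Y \<union> Z) (d f))) = 0"
    using complex by (simp add: is_complex_def)
  then have "restr Z (d (restr (Y \<union> Z) (d f))) = 0"
    by (subst restr_quot(1)) (simp add: restr_0)
  then have "restr Z (d (restr Y (d f)) + d (restr Z (d f))) = 0"
    by (simp add: restr_Un[OF disj] pmp.linear_add[OF lin_d])
  moreover have "restr Z (d (restr Y (d f))) = 0"
    using arrows restr_in[of Y "d f"] by (simp add: no_arrows_def)
  ultimately show "restr Z (d (restr Z (d f))) = 0" by (simp add: restr_add)
qed

text \<open>The middle of the long exact sequence by hand: a primitive in the quotient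
  \<open>Z\<close> corrects the cocycle to one supported in \<open>Y\<close>, where a second
  primitive exists.\<close>

lemma acyclic_at_extension:
  assumes Y: "acyclic_at Y i" and Z: "acyclic_at Z i"
  shows "acyclic_at (Y \<union> Z) i"
  unfolding acyclic_at_def
proof (intro ballI impI)
  let ?W = "Y \<union> Z"
  fix f assume f: "f \<in> supp_in (?W \<inter> level i)" and cocycle: "restr ?W (d f) = 0"
  have f_split: "f = restr Y f + restr Z f"
    using restr_idem[of f ?W] supp_in_mono[OF f, of ?W] restr_Un[OF disj, of f] by simp
  have fY: "restr Y f \<in> supp_in Y" by (rule restr_in)
  have "restr Z (d (restr Z f)) = restr Z (d f) - restr Z (d (restr Y f))"
    by (subst (2) f_split) (simp add: pmp.linear_add[OF lin_d] restr_add)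
  also have "\<dots> = 0"
    using arrows fY restr_quot(1)[of "d f"] cocycle by (simp add: no_arrows_def restr_0)
  finally have "restr Z (d (restr Z f)) = 0" .
  moreover have "restr Z f \<in> supp_in (Z \<inter> level i)"
    using restr_in_Int[OF f, of Z] by (rule supp_in_mono) auto
  ultimately obtain y where y: "y \<in> supp_in (Z \<inter> level (i - 1))" "restr Z (d y) = restr Z f"
    using Z by (auto simp: acyclic_at_def)
  have yW: "y \<in> supp_in (?W \<inter> level (i - 1))" using y(1) by (rule supp_in_mono) auto
  define g where "g = f - restr ?W (d y)"
  have g: "g \<in> supp_in (?W \<inter> level i)"
    unfolding g_def by (intro pm.subspace_diff[OF subspace_supp_in] f restr_d_level[OF yW])
  have "restr Z g = 0"
    using y(2) by (simp add: g_def restr_diff flip: restr_quot(1))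
  then have "restr Y g = g"
    using restr_idem[of g ?W] supp_in_mono[OF g, of ?W] restr_Un[OF disj, of g] by simp
  then have gY: "g \<in> supp_in (Y \<inter> level i)"
    using restr_in_Int[OF g, of Y] by (simp add: supp_in_iff)
  have "restr ?W (d (restr ?W (d y))) = 0"
    using complex supp_in_mono[OF yW, of ?W] by (simp add: is_complex_def)
  then have "restr ?W (d g) = 0"
    using cocycle by (simp add: g_def pmp.linear_diff[OF lin_d] restr_diff)
  then have "restr Y (d g) = 0"
    using restr_quot(2)[of "d g"] by (simp add: restr_0)
  then obtain x where x: "x \<in> supp_in (Y \<inter> level (i - 1))" "restr Y (d x) = g"
    using Y gY by (auto simp: acyclic_at_def)
  have xY: "x \<in> supp_in Y" "x \<in> supp_in (?W \<inter> level (i - 1))"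
    by (rule supp_in_mono[OF x(1)], blast)+
  have "restr ?W (d (x + y)) = f"
    using x(2) by (simp add: pmp.linear_add[OF lin_d] restr_add restr_d_sub[OF xY(1)] g_def)
  moreover have "x + y \<in> supp_in (?W \<inter> level (i - 1))"
    by (intro pm.subspace_add[OF subspace_supp_in] xY(2) yW)
  ultimately show "\<exists>g\<in>supp_in (?W \<inter> level (i - 1)). restr ?W (d g) = f" by blast
qed

end

text \<open>Gaussian elimination: the component of \<open>d\<close> from \<open>Y\<close> to
  \<open>Z\<close> is a bijection of basis elements up to nonzero scalars, with inverse
  \<open>\<psi>\<close>. Subtracting the coboundary of \<open>\<psi>\<close> of the
  \<open>Z\<close>-part leaves a cocycle supported in \<open>Y\<close>, and such a cocycle is
  zero.\<close>

lemma acyclic_at_if_matched: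
  assumes disj: "Y \<inter> Z = {}" and complex: "is_complex (Y \<union> Z)"
    and bij: "bij_betw \<sigma> Y Z"
    and match: "\<And>S. S \<in> Y \<Longrightarrow> restr Z (d (Poly_Mapping.single S 1)) = scale (c S) (Poly_Mapping.single (\<sigma> S) 1)"
    and nz: "\<And>S. S \<in> Y \<Longrightarrow> c S \<noteq> 0"
    and level: "\<And>S i. S \<in> Y \<Longrightarrow> \<sigma> S \<in> level i \<Longrightarrow> S \<in> level (i - 1)"
  shows "acyclic_at (Y \<union> Z) i"
  unfolding acyclic_at_def
proof (intro ballI impI)
  let ?W = "Y \<union> Z"
  define \<tau> where "\<tau> = inv_into Y \<sigma>"
  have \<tau>: "\<tau> T \<in> Y" "\<sigma> (\<tau> T) = T" if "T \<in> Z" for T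
    using that bij_betw_inv_into_right[OF bij] bij_betwE[OF bij_betw_inv_into[OF bij]] by (auto simp: \<tau>_def)
  have \<tau>\<sigma>: "\<tau> (\<sigma> S) = S" "\<sigma> S \<in> Z" if "S \<in> Y" for S
    using that bij_betw_inv_into_left[OF bij] bij_betwE[OF bij] by (auto simp: \<tau>_def)
  define \<psi> where "\<psi> = linear_ext (\<lambda>T. scale (1 / c (\<tau> T)) (Poly_Mapping.single (\<tau> T) 1))"
  have lin_\<psi>: "lin \<psi>" unfolding \<psi>_def by (rule lin_linear_ext)
  have right_inv: "restr Z (d (\<psi> f)) = f" if f: "f \<in> supp_in Z" for f
    by (rule lin_eq_on_supp_in[OF lin_compose[OF lin_\<psi> lin_compose[OF lin_d lin_restr]] pm.linear_ident f])
      (simp add: \<psi>_def pmp.linear_scale[OF lin_d] pmp.linear_scale[OF lin_restr] match \<tau> nz)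
  have left_inv: "\<psi> (restr Z (d f)) = f" if f: "f \<in> supp_in Y" for f
    by (rule lin_eq_on_supp_in[OF lin_compose[OF lin_compose[OF lin_d lin_restr] lin_\<psi>] pm.linear_ident f])
      (simp add: match pmp.linear_scale[OF lin_\<psi>] \<tau>\<sigma> nz, simp add: \<psi>_def \<tau>\<sigma> nz)
  fix f assume f: "f \<in> supp_in (?W \<inter> level i)" and cocycle: "restr ?W (d f) = 0"
  have fZ: "restr Z f \<in> supp_in Z" by (rule restr_in)
  define y where "y = \<psi> (restr Z f)"
  have "restr Z f \<in> supp_in (Z \<inter> level i)"
    using restr_in_Int[OF f, of Z] by (rule supp_in_mono) auto
  then have yY: "y \<in> supp_in (Y \<inter> level (i - 1))"
    unfolding y_def
  proof (rule lin_supp_in_image[OF lin_\<psi> _ subspace_supp_in])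
    fix T assume "T \<in> Z \<inter> level i"
    then have "\<tau> T \<in> Y \<inter> level (i - 1)" using \<tau> level by auto
    then show "\<psi> (Poly_Mapping.single T 1) \<in> supp_in (Y \<inter> level (i - 1))"
      unfolding \<psi>_def linear_ext_single
      by (intro pm.subspace_scale[OF subspace_supp_in] single_in_supp_in)
  qed
  have yW: "y \<in> supp_in (?W \<inter> level (i - 1))" "y \<in> supp_in ?W"
    by (rule supp_in_mono[OF yY], blast)+
  define g where "g = f - restr ?W (d y)"
  have g: "g \<in> supp_in ?W"
    unfolding g_def using supp_in_mono[OF f, of ?W]
    by (intro pm.subspace_diff[OF subspace_supp_in] restr_in) auto
  have sub: "restr Z (restr ?W h) = restr Z h" for h
    by (simp add: restr_restr Int_absorb2)
  have "restr Z g = 0"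
    using right_inv[OF fZ] by (simp add: g_def restr_diff sub y_def)
  then have "restr Y g = g"
    using restr_idem[OF g] restr_Un[OF disj, of g] by simp
  then have gY: "g \<in> supp_in Y" using restr_in[of Y g] by simp
  have "restr ?W (d (restr ?W (d y))) = 0"
    using complex yW(2) by (simp add: is_complex_def)
  then have "restr ?W (d g) = 0"
    using cocycle by (simp add: g_def pmp.linear_diff[OF lin_d] restr_diff)
  then have "restr Z (d g) = 0" using sub[of "d g"] by (simp add: restr_0)
  then have "g = 0" using left_inv[OF gY] by (simp add: pmp.linear_0[OF lin_\<psi>])
  then show "\<exists>g\<in>supp_in (?W \<inter> level (i - 1)). restr ?W (d g) = f"
    using yW(1) by (auto simp: g_def)
qed

end

section \<open>Chromatic cohomology lives on two diagonals\<close>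

lemma single_one_eq_iff:
  "Poly_Mapping.single a (1 :: rat) = Poly_Mapping.single b 1 \<longleftrightarrow> a = b"
  by (metis keys_single zero_neq_one singleton_insert_inj_eq)

lemma single_one_neq_0: "Poly_Mapping.single a (1 :: rat) \<noteq> 0"
  by (metis keys_single keys_zero zero_neq_one insert_not_empty)

context finite_multigraph
begin

text \<open>Labels are read at vertices because components change when edges are added, whereas
  vertices stay. Prescribed labels at base vertices thus make sense across all states.\<close>

definition lab :: "('v, 'e) estate \<Rightarrow> 'v \<Rightarrow> label" where
  "lab S v = the (snd S (cmp (fst S) v))"

lemma label_eq_lab: "S \<in> estates G \<Longrightarrow> v \<in> V \<Longrightarrow> snd S (cmp (fst S) v) = Some (lab S v)"
  by (metis estate_label lab_def option.sel)

lemma lab_cong: "cmp (fst S) u = cmp (fst S) v \<Longrightarrow> lab S u = lab S v"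
  by (simp add: lab_def)

lemma estate_eqI:
  assumes S: "S \<in> estates G" "S' \<in> estates G" and fst: "fst S = fst S'"
    and lab: "\<And>v. v \<in> V \<Longrightarrow> lab S v = lab S' v"
  shows "S = S'"
proof -
  have "snd S P = snd S' P" for P
  proof (cases "P \<in> comps (fst S)")
    case True
    then obtain v where "v \<in> V" "P = cmp (fst S) v" by (auto simp: graph_components_def)
    then show ?thesis using label_eq_lab S fst lab by metis
  next
    case False
    then show ?thesis using estate_dom[OF S(1)] estate_dom[OF S(2)] fst by (metis domIff)
  qed
  then show ?thesis using fst by (simp add: prod_eq_iff fun_eq_iff)
qed

lemma estate_exists:
  assumes "s \<subseteq> E" and const: "\<And>u v. u \<in> V \<Longrightarrow> v \<in> V \<Longrightarrow> cmp s u = cmp s v \<Longrightarrow> f u = f v"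
  shows "\<exists>S\<in>estates G. fst S = s \<and> (\<forall>v\<in>V. lab S v = f v)"
proof -
  define l where "l = (\<lambda>P. if P \<in> comps s then Some (f (SOME v. v \<in> V \<and> P = cmp s v)) else None)"
  have "(s, l) \<in> estates G" using assms(1) by (auto simp: estates_def l_def dom_def)
  moreover have "lab (s, l) v = f v" if v: "v \<in> V" for v
  proof -
    let ?u = "SOME u. u \<in> V \<and> cmp s v = cmp s u"
    have "?u \<in> V \<and> cmp s v = cmp s ?u" by (rule someI_ex) (use v in blast)
    then have "f ?u = f v" using const v by metis
    then show ?thesis using comp_in_comps[OF v, of s] by (simp add: lab_def l_def)
  qed
  ultimately show ?thesis by (intro bexI[of _ "(s, l)"]) auto
qed

lemma lab_loop:
  assumes "cmp (fst S) (tail e) = cmp (fst S) (head e)"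
  shows "lab (insert e (fst S), snd S) v = lab S v"
  by (simp add: lab_def comps_insert_loop(1)[OF assms])

lemma lab_merge:
  assumes ne: "cmp (fst S) (tail e) \<noteq> cmp (fst S) (head e)"
  shows "lab (merge S e c) v =
    (if v \<in> cmp (fst S) (tail e) \<union> cmp (fst S) (head e) then c else lab S v)"
proof (cases "v \<in> cmp (fst S) (tail e) \<union> cmp (fst S) (head e)")
  case True
  then show ?thesis by (simp add: lab_def merge_def merge_labels_def comp_of_insert)
next
  case False
  then have "cmp (fst S) v \<noteq> cmp (fst S) (tail e)" "cmp (fst S) v \<noteq> cmp (fst S) (head e)"
    by (simp_all add: comp_of_eq_iff)
  moreover have "cmp (fst S) v \<noteq> cmp (fst S) (tail e) \<union> cmp (fst S) (head e)"
    using False comp_of_self[of v G "fst S"] by blast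
  ultimately show ?thesis
    using False by (simp add: lab_def merge_def merge_labels_def comp_of_insert)
qed

lemma T_edge_merge_lab:
  assumes S: "S \<in> estates G" and e: "e \<in> E" and ne: "cmp (fst S) (tail e) \<noteq> cmp (fst S) (head e)"
  shows "T_edge G S e = (case label_mult (lab S (tail e)) (lab S (head e)) of
    None \<Rightarrow> 0 | Some c \<Rightarrow> Poly_Mapping.single (merge S e c) 1)"
  by (rule T_edge_merge[OF ne]) (simp_all add: label_eq_lab[OF S] ends_V[OF e])

lemma label_mult_x:
  "label_mult a b = Some c \<Longrightarrow> a = LX \<or> b = LX \<longleftrightarrow> c = LX"
  by (cases a; cases b) auto

text \<open>Products in Q[x]/(x^2) never turn x into 1, and a nonzero product is x exactly when a
  factor is x. These facts decide which sets of states are closed under \<open>d\<close>.\<close>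

lemma T_edge_cases:
  assumes S: "S \<in> estates G" and e: "e \<in> E - fst S"
  obtains "T_edge G S e = 0"
  | S' where "T_edge G S e = Poly_Mapping.single S' 1" "S' \<in> cell (state_dim S + 1) (state_deg S)"
    "fst S' = insert e (fst S)" "\<And>v. v \<in> V \<Longrightarrow> lab S v = LX \<Longrightarrow> lab S' v = LX"
    "lab S (tail e) = LX \<or> lab S (head e) = LX \<longleftrightarrow> lab S' (tail e) = LX"
proof (cases "cmp (fst S) (tail e) = cmp (fst S) (head e)")
  case True
  let ?S' = "(insert e (fst S), snd S)"
  have "T_edge G S e = Poly_Mapping.single ?S' 1" by (rule T_edge_loop[OF True])
  moreover from this have "?S' \<in> cell (state_dim S + 1) (state_deg S)"
    using edge_maps_in_cell(1)[OF S e] by (simp add: supp_in_def)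
  ultimately show ?thesis
    using that(2)[of ?S'] lab_loop[OF True] lab_cong[OF True] by simp
next
  case False
  have eE: "e \<in> E" using e by simp
  show ?thesis
  proof (cases "label_mult (lab S (tail e)) (lab S (head e))")
    case None
    then show ?thesis using that(1) T_edge_merge_lab[OF S eE False] by simp
  next
    case (Some c)
    let ?S' = "merge S e c"
    have T: "T_edge G S e = Poly_Mapping.single ?S' 1"
      using T_edge_merge_lab[OF S eE False] Some by simp
    moreover from this have "?S' \<in> cell (state_dim S + 1) (state_deg S)"
      using edge_maps_in_cell(1)[OF S e] by (simp add: supp_in_def)
    moreover have "fst ?S' = insert e (fst S)" by (simp add: merge_def)
    moreover have "lab ?S' v = LX" if v: "v \<in> V" "lab S v = LX" for v
    proof -
      have "c = LX" if "v \<in> cmp (fst S) (tail e) \<union> cmp (fst S) (head e)"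
        using that label_mult_x[OF Some] v(2) lab_cong[of S v "tail e"] lab_cong[of S v "head e"]
        by (auto simp: comp_of_eq_iff)
      then show ?thesis using v(2) by (auto simp: lab_merge[OF False])
    qed
    moreover have "lab S (tail e) = LX \<or> lab S (head e) = LX \<longleftrightarrow> lab ?S' (tail e) = LX"
      using label_mult_x[OF Some] by (simp add: lab_merge[OF False])
    ultimately show ?thesis by (rule that(2))
  qed
qed

lemma T_edge_singleD:
  assumes S: "S \<in> estates G" "e \<in> E - fst S" and T: "T_edge G S e = Poly_Mapping.single S' 1"
  shows "fst S' = insert e (fst S)" "\<And>v. v \<in> V \<Longrightarrow> lab S v = LX \<Longrightarrow> lab S' v = LX"
    "lab S (tail e) = LX \<or> lab S (head e) = LX \<longleftrightarrow> lab S' (tail e) = LX"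
proof -
  have "fst S' = insert e (fst S) \<and> (\<forall>v\<in>V. lab S v = LX \<longrightarrow> lab S' v = LX) \<and>
    (lab S (tail e) = LX \<or> lab S (head e) = LX \<longleftrightarrow> lab S' (tail e) = LX)"
  proof (rule T_edge_cases[OF S])
    fix S'' assume S'': "T_edge G S e = Poly_Mapping.single S'' 1"
      "fst S'' = insert e (fst S)" "\<And>v. v \<in> V \<Longrightarrow> lab S v = LX \<Longrightarrow> lab S'' v = LX"
      "lab S (tail e) = LX \<or> lab S (head e) = LX \<longleftrightarrow> lab S'' (tail e) = LX"
    then have "S'' = S'" using T by (simp add: single_one_eq_iff)
    then show ?thesis using S''(2-4) by blast
  qed (use T single_one_neq_0[of S'] in simp)
  then show "fst S' = insert e (fst S)" "\<And>v. v \<in> V \<Longrightarrow> lab S v = LX \<Longrightarrow> lab S' v = LX"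
    "lab S (tail e) = LX \<or> lab S (head e) = LX \<longleftrightarrow> lab S' (tail e) = LX"
    by blast+
qed

lemma graded_differential_chrom_d: "graded_differential (chrom_d G) (\<lambda>i. cell i j)"
  by (rule graded_differential.intro) (rule lin_chrom_d, rule chrom_d_closed)

end

section \<open>Deletion and contraction at a fixed degree\<close>

locale finite_multigraph_degree = finite_multigraph G
  for G :: "('v, 'e::linorder) graph" and j :: int
begin

sublocale graded_differential "chrom_d G" "\<lambda>i. cell i j"
  by (rule graded_differential_chrom_d)

lemma no_arrows_edgewise:
  assumes Y: "Y \<subseteq> estates G"
    and T: "\<And>S e S'. S \<in> Y \<Longrightarrow> e \<in> E - fst S \<Longrightarrow> T_edge G S e = Poly_Mapping.single S' 1 \<Longrightarrow>
      S' \<in> Z \<Longrightarrow> False"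
  shows "no_arrows Y Z"
proof (rule no_arrowsI)
  fix S assume S: "S \<in> Y"
  have "restr Z (T_edge G S e) = 0" if e: "e \<in> E - fst S" for e
  proof (rule T_edge_cases[of S e])
    fix S' assume "T_edge G S e = Poly_Mapping.single S' 1"
    moreover from this have "S' \<notin> Z" using T[OF S e] by blast
    ultimately show ?thesis
      using restr_disjoint[OF single_in_supp_in[of S' "{S'}" 1], of Z] by simp
  qed (use S Y e restr_0 in auto)
  then show "restr Z (chrom_d G (Poly_Mapping.single S 1)) = 0"
    by (simp add: chrom_d_single pmp.linear_sum[OF lin_restr] pmp.linear_scale[OF lin_restr])
qed

text \<open>The states of \<open>Z\<close> contain \<open>e\<close> and \<open>S\<close> does not,
  so among the edges that \<open>d\<close> adds only \<open>e\<close> can lead into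
  \<open>Z\<close>.\<close>

lemma restr_chrom_d_single:
  assumes S: "S \<in> estates G" and e: "e \<in> E - fst S" and Z: "\<And>S'. S' \<in> Z \<Longrightarrow> e \<in> fst S'"
  shows "restr Z (chrom_d G (Poly_Mapping.single S 1)) =
    scale (edge_sign (fst S) e) (restr Z (T_edge G S e))"
proof -
  have other: "restr Z (T_edge G S f) = 0" if f: "f \<in> E - fst S - {e}" for f
  proof (rule T_edge_cases[of S f])
    fix S' assume S': "T_edge G S f = Poly_Mapping.single S' 1" "fst S' = insert f (fst S)"
    then have "S' \<notin> Z" using Z[of S'] e f by auto
    then show ?thesis
      using S'(1) restr_disjoint[OF single_in_supp_in[of S' "{S'}" 1], of Z] by simp
  qed (use S f restr_0 in auto)
  have "restr Z (chrom_d G (Poly_Mapping.single S 1)) =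
      (\<Sum>f\<in>E - fst S. scale (edge_sign (fst S) f) (restr Z (T_edge G S f)))"
    by (simp add: chrom_d_single pmp.linear_sum[OF lin_restr] pmp.linear_scale[OF lin_restr])
  also have "\<dots> = (\<Sum>f\<in>{e}. scale (edge_sign (fst S) f) (restr Z (T_edge G S f)))"
    using finite_E e other by (intro sum.mono_neutral_right) auto
  finally show ?thesis by simp
qed

lemma acyclic_at_if_edge_matched:
  assumes disj: "Y \<inter> Z = {}" and complex: "is_complex (Y \<union> Z)"
    and bij: "bij_betw \<sigma> Y Z"
    and Y: "\<And>S. S \<in> Y \<Longrightarrow> S \<in> estates G \<and> e \<in> E - fst S" and Z: "\<And>S. S \<in> Z \<Longrightarrow> e \<in> fst S"
    and match: "\<And>S. S \<in> Y \<Longrightarrow> T_edge G S e = Poly_Mapping.single (\<sigma> S) 1"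
  shows "acyclic_at (Y \<union> Z) i"
proof (rule acyclic_at_if_matched[OF disj complex bij, of "\<lambda>S. edge_sign (fst S) e"])
  fix S assume S: "S \<in> Y"
  then have \<sigma>: "\<sigma> S \<in> Z" using bij_betwE[OF bij] by blast
  note SY = Y[OF S, THEN conjunct1] Y[OF S, THEN conjunct2]
  have "restr Z (chrom_d G (Poly_Mapping.single S 1)) =
      scale (edge_sign (fst S) e) (restr Z (T_edge G S e))"
    using Z by (rule restr_chrom_d_single[OF SY])
  then show "restr Z (chrom_d G (Poly_Mapping.single S 1)) =
      scale (edge_sign (fst S) e) (Poly_Mapping.single (\<sigma> S) 1)"
    by (simp add: match[OF S] restr_idem[OF single_in_supp_in[OF \<sigma>]])
  show "edge_sign (fst S) e \<noteq> 0" by (simp add: edge_sign_def)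
  fix k assume "\<sigma> S \<in> cell k j"
  moreover have "\<sigma> S \<in> cell (state_dim S + 1) (state_deg S)"
    using edge_maps_in_cell(1)[OF SY] by (simp add: match[OF S] supp_in_def)
  ultimately show "S \<in> cell (k - 1) j" using SY by (auto simp: cell_def)
qed

text \<open>States of the minor that contracts \<open>K\<close> and deletes the complement of \<open>F\<close>, with prescribed
  labels \<open>1\<close> on \<open>P\<close> and \<open>x\<close> on \<open>Q\<close>.\<close>

definition minor_states :: "'e set \<Rightarrow> 'e set \<Rightarrow> 'v set \<Rightarrow> 'v set \<Rightarrow> ('v, 'e) estate set" where
  "minor_states K F P Q = {S \<in> estates G. K \<subseteq> fst S \<and> fst S \<subseteq> F \<and>
     (\<forall>v\<in>P. lab S v = LOne) \<and> (\<forall>v\<in>Q. lab S v = LX)}"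

definition transversal :: "'e set \<Rightarrow> 'v set \<Rightarrow> bool" where
  "transversal F P \<longleftrightarrow> P \<subseteq> V \<and> (\<forall>v\<in>V. \<exists>!u. u \<in> P \<and> u \<in> cmp F v)"

lemma transversal_unique:
  assumes "transversal F P" "u \<in> P" "v \<in> P" "cmp F u = cmp F v"
  shows "u = v"
proof -
  have "u \<in> cmp F v" "v \<in> cmp F v" "v \<in> V"
    using assms by (auto simp: transversal_def simp flip: comp_of_eq_iff)
  then show ?thesis using assms unfolding transversal_def by blast
qed

lemma transversal_ex:
  assumes "transversal F P" "v \<in> V"
  obtains u where "u \<in> P" "u \<in> V" "cmp F u = cmp F v"
  using assms unfolding transversal_def by (metis comp_of_eq subsetD)

lemma transversalI:
  assumes "P \<subseteq> V" "\<And>v. v \<in> V \<Longrightarrow> \<exists>u\<in>P. cmp F u = cmp F v"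
    and "\<And>u v. u \<in> P \<Longrightarrow> v \<in> P \<Longrightarrow> cmp F u = cmp F v \<Longrightarrow> u = v"
  shows "transversal F P"
  unfolding transversal_def
proof (intro conjI ballI)
  fix v assume "v \<in> V"
  then obtain u where "u \<in> P" "cmp F u = cmp F v" using assms(2) by blast
  then show "\<exists>!u. u \<in> P \<and> u \<in> cmp F v"
    using assms(3) by (intro ex1I[of _ u]) (auto simp flip: comp_of_eq_iff)
qed (rule assms(1))

lemma card_comps_transversal:
  assumes "transversal F P"
  shows "card (comps F) = card P"
proof -
  have "comps F = cmp F ` P"
    using assms transversal_ex[OF assms]
    by (auto simp: graph_components_def transversal_def image_iff) metis
  moreover have "inj_on (cmp F) P" using transversal_unique[OF assms] by (auto simp: inj_on_def)
  ultimately show ?thesis by (simp add: card_image)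
qed

lemma finite_transversal: "transversal F P \<Longrightarrow> finite P"
  using finite_V finite_subset by (auto simp: transversal_def)

text \<open>The leaves of the induction, with no edge left to add. Each component of
  \<open>K\<close> has one base vertex, so all labels are prescribed and the degree is
  \<open>card Q\<close>, that is \<open>card (comps K) - card P\<close>. This is the origin of the
  position kept fixed in the induction.\<close>

lemma minor_states_trivial:
  assumes tr: "transversal K (P \<union> Q)" and disj: "P \<inter> Q = {}" and S: "S \<in> minor_states K K P Q"
  shows "state_dim S + state_deg S = int (card K) + int (card (comps K)) - int (card P)"
proof -
  have S': "S \<in> estates G" "fst S = K" using S by (auto simp: minor_states_def)
  have labs: "\<And>v. v \<in> P \<Longrightarrow> lab S v = LOne" "\<And>v. v \<in> Q \<Longrightarrow> lab S v = LX"
    using S by (auto simp: minor_states_def)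
  have QV: "Q \<subseteq> V" using tr by (auto simp: transversal_def)
  have "{A. snd S A = Some LX} = cmp K ` Q"
  proof (intro equalityI subsetI)
    fix A assume A: "A \<in> {A. snd S A = Some LX}"
    then obtain v where v: "v \<in> V" "A = cmp K v" using estate_component[OF S'(1)] S'(2) by blast
    then obtain u where u: "u \<in> P \<union> Q" "cmp K u = A" using transversal_ex[OF tr] by metis
    have "lab S u = LX" using A u S'(2) by (simp add: lab_def)
    then show "A \<in> cmp K ` Q" using u labs(1) by fastforce
  next
    fix A assume "A \<in> cmp K ` Q"
    then show "A \<in> {A. snd S A = Some LX}"
      using label_eq_lab[OF S'(1)] S'(2) labs(2) QV by auto
  qed
  moreover have "inj_on (cmp K) Q" using transversal_unique[OF tr] by (auto simp: inj_on_def)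
  ultimately have "state_deg S = int (card Q)" by (simp add: state_deg_def card_image)
  moreover have "card (comps K) = card P + card Q"
    using card_comps_transversal[OF tr] finite_transversal[OF tr] disj by (simp add: card_Un_disjoint)
  ultimately show ?thesis by (simp add: state_dim_def S'(2))
qed

text \<open>An edge inside a component of \<open>K\<close> is a loop for every state above
  \<open>K\<close>. Adding it keeps all labels and matches the states without it with the states
  containing it, just as a loop makes the chromatic polynomial vanish.\<close>

lemma minor_states_loop_acyclic:
  assumes e: "e \<in> F - K" and F: "F \<subseteq> E" and loop: "cmp K (tail e) = cmp K (head e)"
    and complex: "is_complex (minor_states K F P Q)"
  shows "acyclic_at (minor_states K F P Q) i"
proof -
  let ?W = "minor_states K F P Q"
  let ?Y = "{S \<in> ?W. e \<notin> fst S}" and ?Z = "{S \<in> ?W. e \<in> fst S}"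
  let ?\<sigma> = "\<lambda>S :: ('v, 'e) estate. (insert e (fst S), snd S)"
  let ?\<tau> = "\<lambda>S :: ('v, 'e) estate. (fst S - {e}, snd S)"
  have W: "?W = ?Y \<union> ?Z" by auto
  have eE: "e \<in> E" using e F by auto
  have loop': "cmp s (tail e) = cmp s (head e)" if "K \<subseteq> s" for s
    by (rule comp_of_eq, rule subsetD[OF comp_of_mono[OF that]]) (simp flip: loop comp_of_eq_iff)
  have up: "?\<sigma> S \<in> ?Z" if S: "S \<in> ?Y" for S
    using S e loop_in_estates[OF _ eE loop'] lab_loop[OF loop'] by (auto simp: minor_states_def)
  have down: "?\<tau> S \<in> ?Y" if S: "S \<in> ?Z" for S
  proof -
    have S': "S \<in> estates G" "K \<subseteq> fst S - {e}" "insert e (fst S - {e}) = fst S"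
      using S e by (auto simp: minor_states_def)
    note l = loop'[OF S'(2)]
    have "?\<tau> S \<in> estates G"
      using S' comps_insert_loop(2)[OF l] by (auto simp: estate_iff)
    moreover have "lab (?\<tau> S) v = lab S v" for v
      using lab_loop[of "?\<tau> S" e v] l S'(3) by simp
    ultimately show ?thesis using S S'(2) by (auto simp: minor_states_def)
  qed
  have "acyclic_at (?Y \<union> ?Z) i"
  proof (rule acyclic_at_if_edge_matched[where \<sigma> = ?\<sigma> and e = e])
    show "is_complex (?Y \<union> ?Z)" using complex W by simp
    show "bij_betw ?\<sigma> ?Y ?Z"
      by (rule bij_betwI[where g = ?\<tau>]) (use up down in \<open>auto simp: insert_absorb\<close>)
    show "T_edge G S e = Poly_Mapping.single (?\<sigma> S) 1" if "S \<in> ?Y" for S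
      by (rule T_edge_loop[OF loop']) (use that in \<open>auto simp: minor_states_def\<close>)
  qed (use eE in \<open>auto simp: minor_states_def\<close>)
  then show ?thesis using W by simp
qed

end

section \<open>Bridges and the induction over minors\<close>

context finite_multigraph_degree
begin

text \<open>Of the two sides into which removal of the bridge splits its component, the side of
  \<open>u\<close> keeps the base vertex \<open>v\<close>, and \<open>w\<close> serves the
  other.\<close>

lemma transversal_bridge:
  assumes tr: "transversal (insert e s) P" and e: "e \<in> E"
    and ends: "ends G e = (u, w) \<or> ends G e = (w, u)"
    and v: "v \<in> P" "cmp s v = cmp s u" and bridge: "cmp s u \<noteq> cmp s w"
  shows "transversal s (insert w P)"
    "\<And>b. b \<in> P \<Longrightarrow> cmp s b \<noteq> cmp s w"
proof -
  have big: "cmp (insert e s) y =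
      (if y \<in> cmp s u \<union> cmp s w then cmp s u \<union> cmp s w else cmp s y)" for y
    using ends comp_of_insert[of G e s y] by (auto simp: Un_commute)
  have same: "cmp (insert e s) x = cmp (insert e s) y" if "cmp s x = cmp s y" for x y
    using that comp_of_mono[OF subset_insertI, of G s y e] by (intro comp_of_eq) (auto simp: comp_of_eq_iff)
  have uw: "cmp (insert e s) u = cmp (insert e s) w" by (simp add: big)
  have wP: "cmp s b \<noteq> cmp s w" if b: "b \<in> P" for b
  proof
    assume bw: "cmp s b = cmp s w"
    then have "cmp (insert e s) b = cmp (insert e s) v"
      using same[OF bw] same[OF v(2)] uw by simp
    then have "b = v" using transversal_unique[OF tr b v(1)] by simp
    then show False using bw v(2) bridge by simp
  qed
  then show "\<And>b. b \<in> P \<Longrightarrow> cmp s b \<noteq> cmp s w" .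
  show "transversal s (insert w P)"
  proof (rule transversalI)
    have "w \<in> V" using ends ends_V[OF e] by auto
    then show "insert w P \<subseteq> V" using tr by (auto simp: transversal_def)
    fix y assume y: "y \<in> V"
    show "\<exists>b\<in>insert w P. cmp s b = cmp s y"
    proof (cases "y \<in> cmp s u \<union> cmp s w")
      case True
      then show ?thesis using v by (auto dest: comp_of_eq)
    next
      case False
      obtain b where b: "b \<in> P" "cmp (insert e s) b = cmp (insert e s) y"
        using transversal_ex[OF tr y] by metis
      then have "cmp (insert e s) b = cmp s y" using False by (simp add: big)
      moreover from this have "b \<in> cmp s y" using comp_of_self[of b G "insert e s"] by simp
      ultimately show ?thesis using b(1) comp_of_eq[of b G s y] by blast
    qed
  next
    fix a b assume ab: "a \<in> insert w P" "b \<in> insert w P" "cmp s a = cmp s b"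
    then show "a = b"
      using wP[of a] wP[of b] transversal_unique[OF tr _ _ same[OF ab(3)]] by auto
  qed
qed

text \<open>With label 1 on the side of \<open>w\<close>, adding the bridge multiplies the label at
  \<open>u\<close> by 1, so no information is lost. The base vertices do not lie on that side, hence
  their prescribed labels survive.\<close>

lemma bridge_acyclic:
  assumes F: "F \<subseteq> E" and KF: "K \<subseteq> F" and e: "e \<in> F - K"
    and ends: "ends G e = (u, w) \<or> ends G e = (w, u)"
    and bridge: "cmp (F - {e}) u \<noteq> cmp (F - {e}) w"
    and base: "\<And>b. b \<in> P \<union> Q \<Longrightarrow> b \<in> V \<and> cmp (F - {e}) b \<noteq> cmp (F - {e}) w"
  defines "Y \<equiv> {S \<in> minor_states K F P Q. e \<notin> fst S \<and> lab S w = LOne}"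
    and "Z \<equiv> {S \<in> minor_states K F P Q. e \<in> fst S}"
  assumes complex: "is_complex (Y \<union> Z)"
  shows "acyclic_at (Y \<union> Z) i"
proof -
  have eE: "e \<in> E" using e F by blast
  have uwV: "u \<in> V" "w \<in> V" using ends ends_V[OF eE] by auto
  have apart: "cmp s u \<noteq> cmp s w" "b \<in> P \<union> Q \<Longrightarrow> cmp s b \<noteq> cmp s w" if "s \<subseteq> F - {e}" for s b
    using bridge base[of b] comp_of_mono[OF that, of G w] by (auto simp: comp_of_eq_iff)
  have ends_un: "cmp s (tail e) \<union> cmp s (head e) = cmp s u \<union> cmp s w" for s
    using ends by auto
  have ends_ne: "cmp s (tail e) \<noteq> cmp s (head e)" if "s \<subseteq> F - {e}" for s
    using ends apart(1)[OF that] by auto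
  let ?\<sigma> = "\<lambda>S. merge S e (lab S u)"
  have Y_D: "S \<in> estates G" "fst S \<subseteq> F - {e}" "K \<subseteq> fst S" "lab S w = LOne" "e \<in> E - fst S"
    if "S \<in> Y" for S
    using that eE by (auto simp: Y_def minor_states_def)
  have lab_\<sigma>: "lab (?\<sigma> S) y = (if y \<in> cmp (fst S) w then lab S u else lab S y)" if S: "S \<in> Y" for S y
    using lab_merge[OF ends_ne[OF Y_D(2)[OF S]], of "lab S u" y] lab_cong[of S y u]
    by (auto simp: ends_un comp_of_eq_iff)
  have T: "T_edge G S e = Poly_Mapping.single (?\<sigma> S) 1" if S: "S \<in> Y" for S
  proof -
    have "label_mult (lab S (tail e)) (lab S (head e)) = Some (lab S u)"
      using ends Y_D(4)[OF S] by (cases "lab S u") auto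
    then show ?thesis
      using T_edge_merge_lab[OF Y_D(1)[OF S] eE ends_ne[OF Y_D(2)[OF S]]] by simp
  qed
  have \<sigma>_Z: "?\<sigma> S \<in> Z" if S: "S \<in> Y" for S
  proof -
    have "lab (?\<sigma> S) b = lab S b" if "b \<in> P \<union> Q" for b
      using lab_\<sigma>[OF S] apart(2)[OF Y_D(2)[OF S] that] by (simp add: comp_of_eq_iff)
    moreover have "?\<sigma> S \<in> estates G" by (rule merge_in_estates[OF Y_D(1)[OF S] eE])
    moreover have "fst (?\<sigma> S) = insert e (fst S)" by (simp add: merge_def)
    ultimately show ?thesis using S e by (auto simp: Y_def Z_def minor_states_def)
  qed
  have inj: "S = S'" if S: "S \<in> Y" "S' \<in> Y" and eq: "?\<sigma> S = ?\<sigma> S'" for S S'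
  proof (rule estate_eqI[OF Y_D(1)[OF S(1)] Y_D(1)[OF S(2)]])
    have "insert e (fst S) = insert e (fst S')" using arg_cong[OF eq, of fst] by (simp add: merge_def)
    then show fst: "fst S = fst S'" using Y_D(5)[OF S(1)] Y_D(5)[OF S(2)] by (simp add: insert_ident)
    fix y
    show "lab S y = lab S' y"
    proof (cases "y \<in> cmp (fst S) w")
      case True
      then show ?thesis
        using lab_cong[of S y w] lab_cong[of S' y w] fst Y_D(4)[OF S(1)] Y_D(4)[OF S(2)]
        by (simp add: comp_of_eq_iff)
    next
      case False
      then show ?thesis using arg_cong[OF eq, of "\<lambda>S. lab S y"] lab_\<sigma>[OF S(1)] lab_\<sigma>[OF S(2)] fst by simp
    qed
  qed
  \<comment> \<open>The preimage drops the bridge, puts 1 on the component of \<open>w\<close> and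
    keeps every other label.\<close>
  have surj: "S' \<in> ?\<sigma> ` Y" if S': "S' \<in> Z" for S'
  proof -
    let ?s = "fst S' - {e}"
    have Z_D: "S' \<in> estates G" "?s \<subseteq> F - {e}" "K \<subseteq> ?s" "insert e ?s = fst S'" "?s \<subseteq> E"
      using S' F e by (auto simp: Z_def minor_states_def)
    have "\<exists>S\<in>estates G. fst S = ?s \<and> (\<forall>v\<in>V. lab S v = (if v \<in> cmp ?s w then LOne else lab S' v))"
    proof (rule estate_exists[OF Z_D(5)])
      fix x y assume xy: "cmp ?s x = cmp ?s y"
      then have "x \<in> cmp ?s w \<longleftrightarrow> y \<in> cmp ?s w" by (simp flip: comp_of_eq_iff)
      moreover have "x \<in> cmp (fst S') y"
        using xy comp_of_mono[of ?s "fst S'" G y] by (auto simp: comp_of_eq_iff)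
      ultimately show "(if x \<in> cmp ?s w then LOne else lab S' x) = (if y \<in> cmp ?s w then LOne else lab S' y)"
        using lab_cong[of S' x y] by (simp add: comp_of_eq)
    qed
    then obtain S where S: "S \<in> estates G" "fst S = ?s"
      and labS: "\<And>v. v \<in> V \<Longrightarrow> lab S v = (if v \<in> cmp ?s w then LOne else lab S' v)"
      by blast
    have "lab S b = lab S' b" if "b \<in> P \<union> Q" for b
      using labS[of b] base[OF that] apart(2)[OF Z_D(2) that] by (simp add: comp_of_eq_iff)
    then have SY: "S \<in> Y"
      using S S' labS[OF uwV(2)] Z_D(3) by (auto simp: Y_def Z_def minor_states_def)
    have "?\<sigma> S = S'"
    proof (rule estate_eqI[OF merge_in_estates[OF S(1) eE] Z_D(1)])
      show "fst (?\<sigma> S) = fst S'" using S(2) Z_D(4) by (simp add: merge_def)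
      fix y assume y: "y \<in> V"
      have "lab S u = lab S' u"
        using labS[OF uwV(1)] apart(1)[OF Z_D(2)] by (simp add: comp_of_eq_iff)
      moreover have "lab S' y = lab S' u" if "y \<in> cmp ?s w"
      proof (rule lab_cong)
        have "cmp (insert e ?s) y = cmp (insert e ?s) u"
          unfolding comp_of_insert ends_un using that by simp
        then show "cmp (fst S') y = cmp (fst S') u" by (simp only: Z_D(4))
      qed
      ultimately show "lab (?\<sigma> S) y = lab S' y"
        using lab_\<sigma>[OF SY, of y] labS[OF y] S(2) by auto
    qed
    then show ?thesis using SY by blast
  qed
  show ?thesis
  proof (rule acyclic_at_if_edge_matched[OF _ complex, where \<sigma> = ?\<sigma> and e = e])
    show "Y \<inter> Z = {}" by (auto simp: Y_def Z_def)
    have "inj_on ?\<sigma> Y" by (rule inj_onI) (rule inj)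
    moreover have "?\<sigma> ` Y = Z" by (rule equalityI[OF image_subsetI[OF \<sigma>_Z] subsetI[OF surj]])
    ultimately show "bij_betw ?\<sigma> Y Z" by (simp add: bij_betw_def)
    show "S \<in> estates G \<and> e \<in> E - fst S" if "S \<in> Y" for S
      using Y_D(1)[OF that] Y_D(5)[OF that] by (rule conjI)
    show "e \<in> fst S" if "S \<in> Z" for S using that by (simp add: Z_def)
  qed (rule T)
qed

text \<open>The position \<open>card K + card (comps K) - card P\<close> does not change when an edge joining two
  components of \<open>K\<close> is contracted, when an edge is deleted, or when a new base vertex labelled \<open>x\<close>
  appears because a bridge was deleted.\<close>

lemma minor_states_acyclic:
  assumes "K \<subseteq> F" "F \<subseteq> E" "transversal F (P \<union> Q)" "P \<inter> Q = {}"
    and "is_complex (minor_states K F P Q)"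
    and "i + j \<noteq> int (card K) + int (card (comps K)) - int (card P)"
  shows "acyclic_at (minor_states K F P Q) i"
  using assms
proof (induction "card (F - K)" arbitrary: K F Q rule: less_induct)
  case (less K F Q)
  note KF = less.prems(1) and FE = less.prems(2) and tr = less.prems(3) and disj = less.prems(4)
    and complex = less.prems(5) and pos = less.prems(6)
  let ?W = "minor_states K F P Q"
  have finF: "finite F" by (rule finite_subset[OF FE finite_E])
  have finK: "finite K" by (rule finite_subset[OF KF finF])
  consider (eq) "K = F" | (loop) e where "e \<in> F - K" "cmp K (tail e) = cmp K (head e)"
    | (edge) e0 where "e0 \<in> F - K" "cmp K (tail e0) \<noteq> cmp K (head e0)"
    using KF by blast
  then show ?case
  proof cases
    case eq
    \<comment> \<open>Every state of a leaf sits at the position that \<open>pos\<close> excludes,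
      so there are no cochains here and exactness is vacuous.\<close>
    have "?W \<inter> cell i j = {}"
      using minor_states_trivial[of K P Q] tr disj pos eq by (auto simp: cell_def)
    then show ?thesis
      using pm.subspace_0[OF subspace_supp_in]
      by (auto simp: acyclic_at_def pmp.linear_0[OF lin_d] restr_0 dest!: supp_in_empty intro!: bexI[of _ 0])
  next
    case loop
    then show ?thesis using minor_states_loop_acyclic FE complex by blast
  next
    case edge
    have tV: "tail e0 \<in> V" using edge FE ends_V by blast
    \<comment> \<open>\<open>e0\<close> only shows that the \<open>F\<close>-component of
      \<open>v\<close> exceeds its \<open>K\<close>-component. The edge actually used leaves the
      \<open>K\<close>-component of the base vertex \<open>v\<close>, so in every state above
      \<open>K\<close> its inner end \<open>u\<close> has the label of \<open>v\<close>.\<close>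
    obtain v where v: "v \<in> P \<union> Q" "cmp F v = cmp F (tail e0)"
      using transversal_ex[OF tr tV] by metis
    have "tail e0 \<in> cmp F v" "head e0 \<in> cmp F v"
      using v(2) comp_of_step[of e0 F G] edge by (auto simp flip: comp_of_eq_iff)
    moreover have "\<not> (tail e0 \<in> cmp K v \<and> head e0 \<in> cmp K v)"
      using edge(2) by (auto simp flip: comp_of_eq_iff)
    ultimately obtain y where "y \<in> cmp F v" "y \<notin> cmp K v" by blast
    then obtain e u w where e: "e \<in> F" and ends: "ends G e = (u, w) \<or> ends G e = (w, u)"
      and u: "u \<in> cmp K v" and w: "w \<notin> cmp K v"
      by (rule comp_of_leave)
    have uv: "cmp K u = cmp K v" by (rule comp_of_eq[OF u])
    have uw: "cmp K u \<noteq> cmp K w" using w by (auto simp: uv comp_of_eq_iff dest: comp_of_sym)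
    have eK: "e \<notin> K" using comp_of_step[of e K G] ends uw by auto
    have eE: "e \<in> E" using e FE by blast
    have ne: "cmp K (tail e) \<noteq> cmp K (head e)" using ends uw by auto
    let ?F' = "F - {e}"
    have F': "insert e ?F' = F" "K \<subseteq> ?F'" using e eK KF by auto
    have less_card: "card (F - insert e K) < card (F - K)" "card (?F' - K) < card (F - K)"
      by (rule psubset_card_mono[OF finite_Diff[OF finF]]; use e eK in blast)+
    show ?thesis
    proof (cases "cmp ?F' u = cmp ?F' w")
      case True
      \<comment> \<open>Contraction gives the subcomplex and deletion the quotient, since
        \<open>d\<close> adds edges and cannot remove \<open>e\<close>.\<close>
      let ?Y = "minor_states (insert e K) F P Q" and ?Z = "minor_states K ?F' P Q"
      have W: "?W = ?Y \<union> ?Z" "?Y \<inter> ?Z = {}"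
        using e KF eK by (auto simp: minor_states_def)
      have arrows: "no_arrows ?Y ?Z"
      proof (rule no_arrows_edgewise)
        fix S f S' assume S: "S \<in> ?Y" "f \<in> E - fst S" "T_edge G S f = Poly_Mapping.single S' 1" "S' \<in> ?Z"
        have SE: "S \<in> estates G" "e \<in> fst S" "fst S' \<subseteq> ?F'"
          using S(1,4) by (simp_all add: minor_states_def)
        show False using T_edge_singleD(1)[OF SE(1) S(2,3)] SE(2,3) by blast
      qed (auto simp: minor_states_def)
      have cpx: "is_complex (?Y \<union> ?Z)" using complex W(1) by simp
      have "cmp F = cmp ?F'"
      proof
        fix y
        have "cmp ?F' (tail e) = cmp ?F' (head e)" using ends True by auto
        then show "cmp F y = cmp ?F' y" using comps_insert_loop(1)[of ?F' e y] F'(1) by simp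
      qed
      then have tr': "transversal ?F' (P \<union> Q)" using tr by (simp add: transversal_def)
      have "acyclic_at ?Y i"
        using less.hyps[OF less_card(1)] e KF FE tr disj is_complex_sub[OF W(2) arrows cpx] pos
          card_comps_insert[OF eE ne] finK eK by simp
      moreover have "acyclic_at ?Z i"
        using less.hyps[OF less_card(2)] F'(2) FE tr' disj is_complex_quot[OF W(2) arrows cpx] pos
        by blast
      ultimately show ?thesis
        using acyclic_at_extension[OF W(2) arrows cpx] W(1) by simp
    next
      case False
      have vu: "cmp ?F' v = cmp ?F' u"
        using comp_of_mono[OF F'(2), of G v] u by (intro comp_of_eq[symmetric]) blast
      have tr_F: "transversal (insert e ?F') (P \<union> Q)" using tr F'(1) by simp
      note br = transversal_bridge[OF tr_F eE ends v(1) vu False]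
      have wP: "w \<notin> P" using br(2)[of w] by blast
      \<comment> \<open>The states without the bridge are split by the label at \<open>w\<close>:
        with x they form a smaller instance with base vertex \<open>w\<close>, with 1 they cancel
        against the states containing the bridge.\<close>
      let ?Y = "minor_states K ?F' P (insert w Q)"
      let ?Z0 = "{S \<in> ?W. e \<notin> fst S \<and> lab S w = LOne}" and ?Z1 = "{S \<in> ?W. e \<in> fst S}"
      have W: "?W = ?Y \<union> (?Z0 \<union> ?Z1)" "?Y \<inter> (?Z0 \<union> ?Z1) = {}"
        using label.exhaust by (auto simp: minor_states_def)
      have cpx: "is_complex (?Y \<union> (?Z0 \<union> ?Z1))" using complex W(1) by simp
      have wV: "w \<in> V" using ends ends_V[OF eE] by auto
      have vV: "v \<in> V" using v(1) tr by (auto simp: transversal_def)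
      \<comment> \<open>As x at \<open>w\<close> persists, an arrow must add the bridge itself. The
        merged label is then x, also at \<open>v\<close>: if \<open>v\<close> is in \<open>P\<close>
        this contradicts its label 1, and if \<open>v\<close> is in \<open>Q\<close> the product is
        x times x, which is 0.\<close>
      have arrows: "no_arrows ?Y (?Z0 \<union> ?Z1)"
      proof (rule no_arrows_edgewise)
        fix S f S' assume S: "S \<in> ?Y" "f \<in> E - fst S" "T_edge G S f = Poly_Mapping.single S' 1"
          "S' \<in> ?Z0 \<union> ?Z1"
        have SE: "S \<in> estates G" "lab S w = LX" "K \<subseteq> fst S" "e \<notin> fst S"
          using S(1) by (auto simp: minor_states_def)
        note S' = T_edge_singleD[OF SE(1) S(2,3)]
        have "S' \<in> ?Z1" using S(4) S'(2)[OF wV SE(2)] by auto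
        then have fe: "f = e" using S'(1) SE(4) by auto
        have K_S': "K \<subseteq> fst S'" using SE(3) S'(1) by auto
        have "cmp (fst S') v = cmp (fst S') u"
          using comp_of_mono[OF K_S', of G v] u by (intro comp_of_eq[symmetric]) blast
        moreover have "cmp (fst S') u = cmp (fst S') (tail e)"
          using comp_of_step[of e "fst S'" G] S'(1) fe ends by auto
        ultimately have "lab S' v = lab S' (tail e)" by (intro lab_cong) simp
        then have xv': "lab S' v = LX" using S'(3) fe ends SE(2) by auto
        show False
        proof (cases "v \<in> P")
          case True
          then show False using S(4) xv' by (auto simp: minor_states_def)
        next
          case False
          then have "lab S v = LX" using v(1) S(1) by (auto simp: minor_states_def)
          moreover have "cmp (fst S) v = cmp (fst S) u"
            using comp_of_mono[OF SE(3), of G v] u by (intro comp_of_eq[symmetric]) blast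
          ultimately have xu: "lab S u = LX" using lab_cong[of S v u] by simp
          have F'S: "fst S \<subseteq> ?F'" using S(1) by (auto simp: minor_states_def)
          have "cmp (fst S) u \<noteq> cmp (fst S) w"
            using \<open>cmp ?F' u \<noteq> cmp ?F' w\<close> comp_of_mono[OF F'S, of G w] by (auto simp: comp_of_eq_iff)
          then have ne': "cmp (fst S) (tail e) \<noteq> cmp (fst S) (head e)" using ends by auto
          have "T_edge G S e = 0"
            using T_edge_merge_lab[OF SE(1) eE ne'] ends xu SE(2) by auto
          then show False using S(3) fe by (metis single_one_neq_0)
        qed
      qed (auto simp: minor_states_def)
      have "acyclic_at ?Y i"
        using less.hyps[OF less_card(2), of "insert w Q"] F'(2) subset_trans[OF Diff_subset FE] br(1) disj wP
          is_complex_sub[OF W(2) arrows cpx] pos by simp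
      moreover have "acyclic_at (?Z0 \<union> ?Z1) i"
        by (rule bridge_acyclic[OF FE KF _ ends False _ is_complex_quot[OF W(2) arrows cpx]])
          (use e eK br(2) tr in \<open>auto simp: transversal_def\<close>)
      ultimately show ?thesis
        using acyclic_at_extension[OF W(2) arrows cpx] W(1) by simp
    qed
  qed
qed

text \<open>With nothing contracted the components are the single vertices, so the exceptional
  position is \<open>card V - card P\<close>: it is \<open>card V\<close> for the subcomplex with x
  at \<open>v\<close> and one less for the quotient with 1 at \<open>v\<close>.\<close>

lemma chromatic_two_diagonals:
  assumes conn: "connected_graph G" and pos: "i + j < int (card V) - 1 \<or> int (card V) < i + j"
    and f: "f \<in> supp_in (cell i j)" "chrom_d G f = 0"
  shows "\<exists>g\<in>supp_in (cell (i - 1) j). chrom_d G g = f"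
proof -
  obtain v where v: "v \<in> V" using conn by (auto simp: connected_graph_def)
  have tr: "transversal E {v}"
    using conn v by (auto simp: transversal_def connected_graph_def comp_of_def)
  have no_edges: "adj G {} = {}" by (auto simp: adj_def)
  have "comps {} = (\<lambda>u. {u}) ` V"
    by (auto simp: graph_components_def comp_of_def no_edges)
  then have card: "card (comps {}) = card V" by (simp add: card_image)
  let ?Y = "minor_states {} E {} {v}" and ?Z = "minor_states {} E {v} {}"
  have W: "estates G = ?Y \<union> ?Z" "?Y \<inter> ?Z = {}"
    using label.exhaust estate_edges by (auto simp: minor_states_def)
  have arrows: "no_arrows ?Y ?Z"
  proof (rule no_arrows_edgewise)
    fix S e S' assume S: "S \<in> ?Y" "e \<in> E - fst S" "T_edge G S e = Poly_Mapping.single S' 1" "S' \<in> ?Z"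
    have SE: "S \<in> estates G" "lab S v = LX" using S(1) by (simp_all add: minor_states_def)
    have "lab S' v = LX" by (rule T_edge_singleD(2)[OF SE(1) S(2,3) v SE(2)])
    then show False using S(4) by (simp add: minor_states_def)
  qed (auto simp: minor_states_def)
  have cell_sub: "cell k j \<subseteq> estates G" for k by (auto simp: cell_def)
  have d_estates: "chrom_d G h \<in> supp_in (estates G)" if "h \<in> supp_in (estates G)" for h
  proof (rule lin_supp_in_image[OF lin_chrom_d that subspace_supp_in])
    fix S assume S: "S \<in> estates G"
    then have "Poly_Mapping.single S 1 \<in> supp_in (cell (state_dim S) (state_deg S))"
      by (intro single_in_supp_in) (simp add: cell_def)
    from chrom_d_closed[OF this] show "chrom_d G (Poly_Mapping.single S 1) \<in> supp_in (estates G)"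
      by (rule supp_in_mono) (auto simp: cell_def)
  qed
  have "is_complex (estates G)"
    unfolding is_complex_def
  proof
    fix h assume h: "h \<in> supp_in (estates G)"
    show "restr (estates G) (chrom_d G (restr (estates G) (chrom_d G h))) = 0"
      using square_components(1)[OF h] restr_idem[OF d_estates[OF h]] by (simp add: restr_0)
  qed
  then have cpx: "is_complex (?Y \<union> ?Z)" using W(1) by simp
  have "acyclic_at ?Y i"
  proof (rule minor_states_acyclic[OF empty_subsetI subset_refl _ _ is_complex_sub[OF W(2) arrows cpx]])
    show "i + j \<noteq> int (card ({} :: 'e set)) + int (card (comps {})) - int (card ({} :: 'v set))"
      using pos card by simp linarith
  qed (use tr in simp_all)
  moreover have "acyclic_at ?Z i"
  proof (rule minor_states_acyclic[OF empty_subsetI subset_refl _ _ is_complex_quot[OF W(2) arrows cpx]])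
    show "i + j \<noteq> int (card ({} :: 'e set)) + int (card (comps {})) - int (card {v})"
      using pos card by simp linarith
  qed (use tr in simp_all)
  ultimately have "acyclic_at (estates G) i"
    using acyclic_at_extension[OF W(2) arrows cpx] W(1) by simp
  moreover have "estates G \<inter> cell k j = cell k j" for k using cell_sub by blast
  ultimately obtain g where g: "g \<in> supp_in (cell (i - 1) j)" "restr (estates G) (chrom_d G g) = f"
    using f by (auto simp: acyclic_at_def restr_0)
  have "restr (estates G) (chrom_d G g) = chrom_d G g"
    by (rule restr_idem[OF d_estates[OF supp_in_mono[OF g(1) cell_sub]]])
  then show ?thesis using g by auto
qed

end

theorem mainTheorem7:
  fixes G :: "('v, 'e::linorder) graph" and n :: nat and i j :: int
  assumes "finite_graph G" and "connected_graph G" and "card (verts G) = n"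
  shows "\<exists>\<phi>. \<phi> \<in> linear_iso rat_field
    (quot_module (H_Phi_d_le G i j) (carrier (H_Phi_d_le G i (j - 1))))
    (cohomology (chrom_H G (i - 1) (j + 2)) (Phi_H G (i - 1) (j + 2))
                (chrom_H G i j) (Phi_H G i j)
                (chrom_H G (i + 1) (j - 2)))"
proof -
  interpret finite_multigraph G by unfold_locales fact
  interpret K: knight_move_complex "estates G" state_dim state_deg "chrom_d G" "Phi G" "int n"
    "\<lambda>i j. {S \<in> estates G. state_dim S = i \<and> state_deg S = j}"
    "\<lambda>i j. {S \<in> estates G. state_dim S = i \<and> state_deg S \<le> j}"
    "\<lambda>i. {S \<in> estates G. state_dim S = i}"
  proof (rule knight_move_complex.intro)
    fix f i j assume *: "f \<in> supp_in {S \<in> estates G. state_dim S = i \<and> state_deg S = j}"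
      "chrom_d G f = 0" "i + j < int n - 1 \<or> int n < i + j"
    \<comment> \<open>The induction over minors runs at one fixed degree, so its locale is entered
      anew for each \<open>j\<close>.\<close>
    interpret finite_multigraph_degree G j ..
    show "\<exists>g\<in>supp_in {S \<in> estates G. state_dim S = i - 1 \<and> state_deg S = j}. chrom_d G g = f"
      using chromatic_two_diagonals[OF assms(2), of i f] assms(3) * by (simp add: cell_def)
  qed (use lin_chrom_d lin_Phi chrom_d_closed Phi_closed square_components in
      \<open>simp_all add: cell_def state_deg_def\<close>)
  \<comment> \<open>Once the total differentials agree, the abstract groups and those of the theorem
    differ only by unfolding.\<close>
  have "K.D = Phi_d G" by (simp add: fun_eq_iff K.D_def Phi_d_def)
  then show ?thesis
    using K.collapse[of i j]
    unfolding K.H_le_def K.H_tot_def K.H_sub_def K.H_d_def K.H_Phi_def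
      H_Phi_d_le_def H_Phi_d_def H_Phi_d_sub_def chrom_H_def Phi_H_def Coch_def Coch_le_def Coch_all_def
    by simp
qed

end
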